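(* Let $f:\mathbb{R}^d\to\mathbb{R}$ be convex and continuously differentiable with $L$-Lipschitz continuous gradient and $\operatorname{argmin} f\neq\emptyset$, and let $\sigma:\mathbb{R}_+\times\mathbb{R}^d\to\mathbb{R}^{d\times m}$ be measurable with entries satisfying $\sup_{t\ge 0,x\in\mathbb{R}^d}|\sigma_{ik}(t,x)|<\infty$ and $|\sigma_{ik}(t,x')-\sigma_{ik}(t,x)|\le l_0\|x'-x\|$ for some $l_0>0$ and all $t\ge0$, $x,x'\in\mathbb{R}^d$. Assume that there exist $K\ge0$ and $\beta\in[0,1[$ such that $$\int_0^t(s+1)\sigma_\infty^2(s)\,ds\le Kt^\beta,\qquad\forall t\ge0.$$ Let $X_0\in\mathbb{R}^d$. Then the solution $X\in S_d^2$ of $$dX(t)=-\nabla f(X(t))\,dt+\sigma(t,X(t))\,dW(t),\quad t>0,\qquad X(0)=X_0$$ satisfies $$\mathbb{E}\left(f(X(t))-\min f\right)=\mathcal{O}(t^{\beta-1}).$$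
   Context: $(\Omega,\mathcal{F},\{\mathcal{F}_t\}_{t\ge0},\mathbb{P})$ is a filtered probability space and $W$ is an $\mathcal{F}_t$-adapted $m$-dimensional Brownian motion on it. $\sigma_\infty(t):=\sup_{x\in\mathbb{R}^d}\|\sigma(t,x)\|_F$, with $\|\cdot\|_F$ the Frobenius norm. Two processes $X,Y:\Omega\times[0,T]\to\mathbb{R}^d$ are identified if almost surely $X(t)=Y(t)$ for all $t\in[0,T]$. $S_d^0[0,T]$ is the set (modulo this identification) of progressively measurable continuous processes $X:\Omega\times[0,T]\to\mathbb{R}^d$; $S_d^2[0,T]$ is the set of $X\in S_d^0[0,T]$ with $\mathbb{E}(\sup_{t\in[0,T]}\|X(t)\|^2)<+\infty$, and $S_d^2:=\bigcap_{T\ge0}S_d^2[0,T]$. The SDE has a unique solution in $S_d^2$ under the stated hypotheses. *)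

theory Defs
  imports "HOL-Probability.Probability" "HOL-Library.Landau_Symbols"
begin

text \<open>
  A process is a function \<open>X :: real \<Rightarrow> 'w \<Rightarrow> 'b\<close>, time first; only its values at times
  \<open>t \<ge> 0\<close> are ever constrained or used.  A vector in d-space is a \<open>real ^ 'd\<close>, a matrix with
  d rows and m columns is a \<open>real ^ 'm ^ 'd\<close>.
\<close>

definition frobenius_norm :: "real ^ 'm ^ 'd \<Rightarrow> real" where
  "frobenius_norm A = sqrt (\<Sum>i\<in>UNIV. \<Sum>k\<in>UNIV. (A $ i $ k)\<^sup>2)"

lemma frobenius_norm_eq_norm: "frobenius_norm A = norm A"
  by (simp add: frobenius_norm_def norm_vec_def L2_set_def sum_nonneg)

definition sigma_inf :: "(real \<Rightarrow> real ^ 'd \<Rightarrow> real ^ 'm ^ 'd) \<Rightarrow> real \<Rightarrow> real" where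
  "sigma_inf \<sigma> t = (SUP x. frobenius_norm (\<sigma> t x))"

text \<open>No completeness or right-continuity of the filtration is required.\<close>

locale filtered_prob_space = prob_space M
  for M :: "'w measure" and F :: "real \<Rightarrow> 'w measure" +
  assumes subalgebra_F: "\<And>t. 0 \<le> t \<Longrightarrow> subalgebra M (F t)"
    and F_mono: "\<And>s t. 0 \<le> s \<Longrightarrow> s \<le> t \<Longrightarrow> subalgebra (F t) (F s)"

text \<open>
  The density in \<open>W_increment_normal\<close> is that of the centred normal distribution with
  covariance matrix \<open>t - s\<close> times the identity; \<open>normal_density\<close> takes the standard deviation.
\<close>

locale brownian_motion = filtered_prob_space M F
  for M :: "'w measure" and F :: "real \<Rightarrow> 'w measure" +
  fixes W :: "real \<Rightarrow> 'w \<Rightarrow> real ^ 'm"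
  assumes W_adapted: "\<And>t. 0 \<le> t \<Longrightarrow> W t \<in> borel_measurable (F t)"
    and W_0: "AE \<omega> in M. W 0 \<omega> = 0"
    and W_continuous: "AE \<omega> in M. continuous_on {0..} (\<lambda>t. W t \<omega>)"
    and W_increment_normal: "\<And>s t. 0 \<le> s \<Longrightarrow> s < t \<Longrightarrow>
      distributed M lborel (\<lambda>\<omega>. W t \<omega> - W s \<omega>)
        (\<lambda>x. ennreal (\<Prod>k\<in>UNIV. normal_density 0 (sqrt (t - s)) (x $ k)))"
    and W_increment_indep: "\<And>s t. 0 \<le> s \<Longrightarrow> s < t \<Longrightarrow>
      indep_set (sets (F s)) {(\<lambda>\<omega>. W t \<omega> - W s \<omega>) -` A \<inter> space M | A. A \<in> sets borel}"

definition prog_measurable_upto ::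
  "(real \<Rightarrow> 'w measure) \<Rightarrow> real \<Rightarrow> (real \<Rightarrow> 'w \<Rightarrow> 'b::topological_space) \<Rightarrow> bool" where
  "prog_measurable_upto F T X \<longleftrightarrow>
     (\<forall>t\<in>{0..T}. (\<lambda>(s, \<omega>). X s \<omega>)
        \<in> borel_measurable (restrict_space borel {0..t} \<Otimes>\<^sub>M F t))"

text \<open>
  Representatives of the elements of the spaces of continuous processes.  Quotients are not
  formed: membership of a given process is what is stated.
\<close>

definition S0_upto ::
  "'w measure \<Rightarrow> (real \<Rightarrow> 'w measure) \<Rightarrow> real \<Rightarrow> (real \<Rightarrow> 'w \<Rightarrow> real ^ 'd) set" where
  "S0_upto M F T = {X. prog_measurable_upto F T X \<and>
     (\<forall>\<omega>\<in>space M. continuous_on {0..T} (\<lambda>t. X t \<omega>))}"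

definition S2_upto ::
  "'w measure \<Rightarrow> (real \<Rightarrow> 'w measure) \<Rightarrow> real \<Rightarrow> (real \<Rightarrow> 'w \<Rightarrow> real ^ 'd) set" where
  "S2_upto M F T = {X \<in> S0_upto M F T.
     (\<integral>\<^sup>+\<omega>. (SUP t\<in>{0..T}. ennreal ((norm (X t \<omega>))\<^sup>2)) \<partial>M) < \<infinity>}"

definition S2 ::
  "'w measure \<Rightarrow> (real \<Rightarrow> 'w measure) \<Rightarrow> (real \<Rightarrow> 'w \<Rightarrow> real ^ 'd) set" where
  "S2 M F = (\<Inter>T\<in>{0..}. S2_upto M F T)"

text \<open>
  A simple integrand is given by a number \<open>N\<close> of steps, a partition \<open>\<tau> 0 \<le> \<dots> \<le> \<tau> N\<close>, and
  bounded matrix-valued random variables \<open>\<xi> i\<close> known at time \<open>\<tau> i\<close>.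
\<close>

definition simple_integrand ::
  "'w measure \<Rightarrow> (real \<Rightarrow> 'w measure) \<Rightarrow> nat \<Rightarrow> (nat \<Rightarrow> real)
     \<Rightarrow> (nat \<Rightarrow> 'w \<Rightarrow> real ^ 'm ^ 'd) \<Rightarrow> bool" where
  "simple_integrand M F N \<tau> \<xi> \<longleftrightarrow>
     0 \<le> \<tau> 0 \<and> (\<forall>i<N. \<tau> i \<le> \<tau> (Suc i)) \<and>
     (\<forall>i<N. \<xi> i \<in> borel_measurable (F (\<tau> i))) \<and>
     (\<exists>C. \<forall>i<N. \<forall>\<omega>\<in>space M. frobenius_norm (\<xi> i \<omega>) \<le> C)"

definition simple_value ::
  "nat \<Rightarrow> (nat \<Rightarrow> real) \<Rightarrow> (nat \<Rightarrow> 'w \<Rightarrow> real ^ 'm ^ 'd) \<Rightarrow> real \<Rightarrow> 'w \<Rightarrow> real ^ 'm ^ 'd" where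
  "simple_value N \<tau> \<xi> t \<omega> =
     (\<Sum>i<N. indicator {\<tau> i<..\<tau> (Suc i)} t *\<^sub>R \<xi> i \<omega>)"

definition ito_simple_integral ::
  "(real \<Rightarrow> 'w \<Rightarrow> real ^ 'm) \<Rightarrow> nat \<Rightarrow> (nat \<Rightarrow> real) \<Rightarrow> (nat \<Rightarrow> 'w \<Rightarrow> real ^ 'm ^ 'd)
     \<Rightarrow> real \<Rightarrow> 'w \<Rightarrow> real ^ 'd" where
  "ito_simple_integral W N \<tau> \<xi> t \<omega> =
     (\<Sum>i<N. \<xi> i \<omega> *v (W (min t (\<tau> (Suc i))) \<omega> - W (min t (\<tau> i)) \<omega>))"

text \<open>
  \<open>I\<close> is a continuous version of the Ito integral process of \<open>H\<close> against \<open>W\<close>, for progressively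
  measurable \<open>H\<close> that is square integrable on every bounded time interval: the mean-square
  limit of the integrals of simple integrands approximating \<open>H\<close>.  Any two such \<open>I\<close> are
  indistinguishable.
\<close>

definition ito_integral ::
  "'w measure \<Rightarrow> (real \<Rightarrow> 'w measure) \<Rightarrow> (real \<Rightarrow> 'w \<Rightarrow> real ^ 'm)
     \<Rightarrow> (real \<Rightarrow> 'w \<Rightarrow> real ^ 'm ^ 'd) \<Rightarrow> (real \<Rightarrow> 'w \<Rightarrow> real ^ 'd) \<Rightarrow> bool" where
  "ito_integral M F W H I \<longleftrightarrow>
     (\<forall>T\<ge>0. prog_measurable_upto F T H \<and>
        (\<integral>\<^sup>+\<omega>. (\<integral>\<^sup>+s\<in>{0..T}. ennreal ((frobenius_norm (H s \<omega>))\<^sup>2) \<partial>lborel) \<partial>M) < \<infinity>) \<and>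
     (\<forall>t\<ge>0. I t \<in> borel_measurable M) \<and>
     (AE \<omega> in M. continuous_on {0..} (\<lambda>t. I t \<omega>)) \<and>
     (\<exists>N \<tau> \<xi>.
        (\<forall>n. simple_integrand M F (N n) (\<tau> n) (\<xi> n)) \<and>
        (\<forall>T\<ge>0.
          (\<lambda>n. \<integral>\<^sup>+\<omega>. (\<integral>\<^sup>+s\<in>{0..T}. ennreal
             ((frobenius_norm (simple_value (N n) (\<tau> n) (\<xi> n) s \<omega> - H s \<omega>))\<^sup>2) \<partial>lborel) \<partial>M)
            \<longlonglongrightarrow> 0 \<and>
          (\<lambda>n. \<integral>\<^sup>+\<omega>. ennreal
             ((norm (ito_simple_integral W (N n) (\<tau> n) (\<xi> n) T \<omega> - I T \<omega>))\<^sup>2) \<partial>M)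
            \<longlonglongrightarrow> 0))"

text \<open>
  \<open>X\<close> solves \<open>dX(t) = b(X(t)) dt + \<sigma>(t, X(t)) dW(t)\<close>, \<open>X(0) = x0\<close>, in the integral sense.
\<close>

definition sde_solution ::
  "'w measure \<Rightarrow> (real \<Rightarrow> 'w measure) \<Rightarrow> (real \<Rightarrow> 'w \<Rightarrow> real ^ 'm)
     \<Rightarrow> (real ^ 'd \<Rightarrow> real ^ 'd) \<Rightarrow> (real \<Rightarrow> real ^ 'd \<Rightarrow> real ^ 'm ^ 'd)
     \<Rightarrow> real ^ 'd \<Rightarrow> (real \<Rightarrow> 'w \<Rightarrow> real ^ 'd) \<Rightarrow> bool" where
  "sde_solution M F W b \<sigma> x0 X \<longleftrightarrow>
     (\<exists>I. ito_integral M F W (\<lambda>t \<omega>. \<sigma> t (X t \<omega>)) I \<and>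
        (AE \<omega> in M. \<forall>t\<ge>0. X t \<omega> = x0 + (LINT s:{0..t}|lborel. b (X s \<omega>)) + I t \<omega>))"

end

theory Submission
  imports Defs
begin

text \<open>
  Along a solution, the function \<open>V(t) = t (f(X(t)) - min f) + \<parallel>X(t) - z\<parallel>\<^sup>2 / 2\<close>, with \<open>z\<close> a
  minimiser, grows in expectation by at most a constant times
  \<open>\<integral> (s + 1) \<sigma>\<^sub>\<infinity>(s)\<^sup>2 ds\<close>: the drift contributes \<open>f(X) - min f - \<langle>\<nabla>f(X), X - z\<rangle> - t \<parallel>\<nabla>f(X)\<parallel>\<^sup>2 \<le> 0\<close>.
  Dividing by \<open>t\<close> gives the rate.

  Since \<open>f\<close> is only continuously differentiable, no Ito formula is used.  On a uniform partition
  of \<open>[0, T]\<close> each increment of \<open>V\<close> is estimated by the descent inequality and convexity.  Of the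
  stochastic integral only two facts enter: its increments are orthogonal to the past, and their
  second moments are controlled by those of the integrand (up to a constant, which the rate does
  not see).  The discretisation error is \<open>T\<close> times the expectation of the modulus of continuity of
  the path times an envelope of the path, and vanishes by dominated convergence.
\<close>

text \<open>On a step of length d the growing time factor costs d times the gap, and convexity
  bounds this by d times \<open>g \<bullet> (x - z)\<close>, which is what the drift of half the
  squared distance returns. The weight (s + 1) on the noise is the second-order cost: t times
  \<open>L\<close> from the descent inequality, and 1/2 from the squared distance. All expansions
  are made at the left endpoint of the step, so that the coefficient of the stochastic increment is
  known at that time and the first-order noise term has mean zero. The discretisation error of one
  step must be of smaller order than d, because about T / d of them are added; this is why each
  error carries an oscillation as a factor. The isometry is replaced by an inequality: bounding a
  matrix by its Frobenius norm costs a factor \<open>CARD('m)\<close>, and the passage from simple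
  integrands to the limit costs a factor 4.\<close>

lemma borel_measurable_vec_component [measurable (raw)]:
  fixes g :: "'w \<Rightarrow> 'a::second_countable_topology ^ 'n"
  assumes "g \<in> borel_measurable N" shows "(\<lambda>x. g x $ k) \<in> borel_measurable N"
  by (rule borel_measurable_continuous_on[OF _ assms]) (intro continuous_intros)

section \<open>Brownian increments: marginals, moments, independence of the past\<close>

context brownian_motion begin

lemma F_measurableD:
  assumes "0 \<le> t" "g \<in> measurable (F t) N" shows "g \<in> measurable M N"
  using subalgebra_F[OF assms(1)] assms(2) by (rule measurable_from_subalg)

lemma F_measurable_mono:
  assumes "0 \<le> s" "s \<le> t" "g \<in> measurable (F s) N" shows "g \<in> measurable (F t) N"
  using F_mono[OF assms(1,2)] assms(3) by (rule measurable_from_subalg)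

lemma W_measurable: "0 \<le> t \<Longrightarrow> W t \<in> borel_measurable M"
  using W_adapted F_measurableD by blast

text \<open>Tonelli for the product density: every coordinate other than \<open>k\<close> integrates
  to 1.\<close>

lemma W_increment_component_distributed:
  assumes st: "0 \<le> s" "s < t"
  shows "distributed M lborel (\<lambda>\<omega>. (W t \<omega> - W s \<omega>) $ k) (normal_density 0 (sqrt (t - s)))"
proof -
  let ?Y = "\<lambda>\<omega>. W t \<omega> - W s \<omega>" and ?g = "normal_density 0 (sqrt (t - s))"
  have pos: "0 < sqrt (t - s)" using st by simp
  have [measurable]: "W t \<in> borel_measurable M" "W s \<in> borel_measurable M"
    using W_measurable st by auto
  have Yk[measurable]: "(\<lambda>\<omega>. ?Y \<omega> $ k) \<in> borel_measurable M"
    by measurable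
  have "emeasure (distr M lborel (\<lambda>\<omega>. ?Y \<omega> $ k)) A = emeasure (density lborel ?g) A"
    if "A \<in> sets lborel" for A
  proof -
    have A[measurable]: "A \<in> sets borel" using that by simp
    have ind: "(\<lambda>x::real^'m. indicator A (x $ k) :: ennreal) \<in> borel_measurable lborel"
      by measurable
    \<comment> \<open>The indicator of \<open>A\<close> is attached to the factor of coordinate
      \<open>k\<close>, which turns the whole integrand into a product over the basis.\<close>
    define h where "h b x = ennreal (?g x) * (if b = axis k 1 then indicator A x else 1)"
      for b :: "real^'m" and x
    have Basis: "(Basis :: (real^'m) set) = range (\<lambda>j. axis j 1)"
      by (auto simp: Basis_vec_def)
    have inj: "inj (\<lambda>j::'m. axis j (1::real))"
      by (auto intro: injI simp: axis_eq_axis)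
    have reidx: "(\<Prod>b\<in>Basis. G b) = (\<Prod>j\<in>UNIV. G (axis j 1))" for G :: "real^'m \<Rightarrow> ennreal"
      unfolding Basis by (subst prod.reindex[OF inj]) simp
    have split: "(\<Prod>j\<in>UNIV. u j * (if axis j (1::real) = axis k 1 then v j else 1)) = prod u UNIV * v k"
      for u v :: "'m \<Rightarrow> ennreal"
      by (simp add: prod.distrib axis_eq_axis)
    have g1: "(\<integral>\<^sup>+x. ennreal (?g x) \<partial>lborel) = 1"
      using prob_space.emeasure_space_1[OF prob_space_normal_density[OF pos, of 0]]
      by (simp add: emeasure_density)
    have "emeasure (distr M lborel (\<lambda>\<omega>. ?Y \<omega> $ k)) A = (\<integral>\<^sup>+\<omega>. indicator A (?Y \<omega> $ k) \<partial>M)"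
      by (subst nn_integral_indicator[symmetric], use that in simp, subst nn_integral_distr) auto
    also have "\<dots> = (\<integral>\<^sup>+x. ennreal (\<Prod>j\<in>UNIV. ?g (x $ j)) * indicator A (x $ k) \<partial>lborel)"
      using distributed_nn_integral[OF W_increment_normal[OF st] ind] by simp
    also have "\<dots> = (\<integral>\<^sup>+x. (\<Prod>b\<in>Basis. h b (x \<bullet> b)) \<partial>lborel)"
      by (intro nn_integral_cong) (simp add: reidx h_def split prod_ennreal inner_axis)
    also have "\<dots> = (\<Prod>b\<in>Basis. (\<integral>\<^sup>+x. h b x \<partial>lborel))"
      by (rule nn_integral_lborel_prod) (auto simp: h_def)
    also have "\<dots> = (\<Prod>j\<in>UNIV. 1 * (if axis j (1::real) = axis k 1 then (\<integral>\<^sup>+x. ennreal (?g x) * indicator A x \<partial>lborel) else 1))"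
      unfolding reidx h_def by (intro prod.cong) (auto simp: g1)
    also have "\<dots> = (\<integral>\<^sup>+x. ennreal (?g x) * indicator A x \<partial>lborel)"
      by (subst split) simp
    finally show ?thesis by (simp add: emeasure_density)
  qed
  then have "distr M lborel (\<lambda>\<omega>. ?Y \<omega> $ k) = density lborel ?g"
    by (intro measure_eqI) auto
  then show ?thesis by (simp add: distributed_def)
qed

lemma W_increment_component_moments:
  assumes st: "0 \<le> s" "s < t"
  shows "integrable M (\<lambda>\<omega>. (W t \<omega> - W s \<omega>) $ k)"
    and "expectation (\<lambda>\<omega>. (W t \<omega> - W s \<omega>) $ k) = 0"
    and "integrable M (\<lambda>\<omega>. ((W t \<omega> - W s \<omega>) $ k)\<^sup>2)"
    and "expectation (\<lambda>\<omega>. ((W t \<omega> - W s \<omega>) $ k)\<^sup>2) = t - s"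
proof -
  let ?Y = "\<lambda>\<omega>. (W t \<omega> - W s \<omega>) $ k" and ?g = "normal_density 0 (sqrt (t - s))"
  have pos: "0 < sqrt (t - s)" using st by simp
  note D = W_increment_component_distributed[OF st, of k]
  show "integrable M ?Y"
    using distributed_integrable[OF D, of "\<lambda>x. x"] integrable_normal_moment_nz_1[OF pos, of 0] by simp
  show E: "expectation ?Y = 0"
    using normal_distributed_expectation[OF pos D] .
  show "integrable M (\<lambda>\<omega>. (?Y \<omega>)\<^sup>2)"
    using distributed_integrable[OF D, of "\<lambda>x. x\<^sup>2"] integrable_normal_moment[OF pos, of 0 2] by simp
  show "expectation (\<lambda>\<omega>. (?Y \<omega>)\<^sup>2) = t - s"
    using normal_distributed_variance[OF pos D] E st by simp
qed

text \<open>Independence of the sigma-algebras passes to the smaller ones generated by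
  \<open>Z\<close> and by \<open>h\<close> of the increment.\<close>

lemma W_increment_indep_var:
  fixes Z :: "'w \<Rightarrow> real" and h :: "real^'m \<Rightarrow> real"
  assumes st: "0 \<le> s" "s < t" and Z: "Z \<in> borel_measurable (F s)" and h: "h \<in> borel_measurable borel"
  shows "indep_var borel Z borel (\<lambda>\<omega>. h (W t \<omega> - W s \<omega>))"
proof -
  let ?Y = "\<lambda>\<omega>. W t \<omega> - W s \<omega>"
  have [measurable]: "W t \<in> borel_measurable M" "W s \<in> borel_measurable M" "Z \<in> borel_measurable M"
    using W_measurable st Z F_measurableD by auto
  note [measurable] = h
  have spF: "space (F s) = space M" using subalgebra_F[OF st(1)] by (auto simp: subalgebra_def)
  let ?B = "{?Y -` A \<inter> space M | A. A \<in> sets borel}"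
  \<comment> \<open>The preimages under the increment already form a sigma-algebra, so generating
    one from some of them does not leave \<open>?B\<close>.\<close>
  have B: "?B = sets (vimage_algebra (space M) ?Y borel)"
    by (simp add: sets_vimage_algebra2)
  have s1: "sigma_sets (space M) {Z -` A \<inter> space M |A. A \<in> sets borel} \<subseteq> sets (F s)"
    unfolding spF[symmetric] by (rule sets.sigma_sets_subset) (use measurable_sets[OF Z] in auto)
  have "{(\<lambda>\<omega>. h (?Y \<omega>)) -` A \<inter> space M |A. A \<in> sets borel} \<subseteq> ?B"
  proof safe
    fix A :: "real set" assume "A \<in> sets borel"
    then show "\<exists>A'. (\<lambda>\<omega>. h (?Y \<omega>)) -` A \<inter> space M = ?Y -` A' \<inter> space M \<and> A' \<in> sets borel"
      using measurable_sets[OF h] by (intro exI[of _ "h -` A"]) auto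
  qed
  then have s2: "sigma_sets (space M) {(\<lambda>\<omega>. h (?Y \<omega>)) -` A \<inter> space M |A. A \<in> sets borel} \<subseteq> ?B"
    unfolding B using sets.sigma_sets_subset[of _ "vimage_algebra (space M) ?Y borel"] by simp
  have "indep_set (sigma_sets (space M) {Z -` A \<inter> space M |A. A \<in> sets borel})
      (sigma_sets (space M) {(\<lambda>\<omega>. h (?Y \<omega>)) -` A \<inter> space M |A. A \<in> sets borel})"
    using W_increment_indep[OF st] unfolding indep_set_def
    by (rule indep_sets_mono_sets) (use s1 s2 in \<open>auto split: bool.splits\<close>)
  then show ?thesis by (simp add: indep_var_eq)
qed

end

section \<open>Matrices acting on vectors, and square integrable random vectors\<close>

text \<open>Cauchy-Schwarz row by row; \<open>norm\<close> on matrices is the Frobenius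
  norm.\<close>

lemma norm_matrix_vector_mult_le: "norm (A *v x) \<le> norm (A :: real^'m^'d) * norm x"
proof (rule power2_le_imp_le)
  have "(norm (A *v x))\<^sup>2 = (\<Sum>i\<in>UNIV. (A $ i \<bullet> x)\<^sup>2)"
    by (simp add: norm_vec_def L2_set_def sum_nonneg matrix_vector_mul_component)
  also have "\<dots> \<le> (\<Sum>i\<in>UNIV. (norm (A $ i))\<^sup>2 * (norm x)\<^sup>2)"
    by (intro sum_mono) (metis Cauchy_Schwarz_ineq2 abs_ge_zero power2_abs power_mono power_mult_distrib)
  also have "\<dots> = (norm A * norm x)\<^sup>2"
    by (simp add: norm_vec_def[of A] L2_set_def sum_nonneg power_mult_distrib sum_distrib_right)
  finally show "(norm (A *v x))\<^sup>2 \<le> (norm A * norm x)\<^sup>2" .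
qed simp

lemma bounded_bilinear_matrix_vector_mult:
  "bounded_bilinear ((*v) :: real^'m^'d \<Rightarrow> real^'m \<Rightarrow> real^'d)"
proof
  show "\<exists>K. \<forall>(A::real^'m^'d) x. norm (A *v x) \<le> norm A * norm x * K"
    using norm_matrix_vector_mult_le by (intro exI[of _ 1]) auto
qed (auto simp: matrix_vector_mult_add_rdistrib matrix_vector_right_distrib
    scaleR_matrix_vector_assoc matrix_vector_mult_scaleR)

lemma borel_measurable_matrix_vector_mult [measurable (raw)]:
  fixes A :: "'w \<Rightarrow> real^'m^'d" and x :: "'w \<Rightarrow> real^'m"
  assumes "A \<in> borel_measurable N" "x \<in> borel_measurable N"
  shows "(\<lambda>\<omega>. A \<omega> *v x \<omega>) \<in> borel_measurable N"
  using assms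
  by (rule borel_measurable_continuous_Pair)
    (intro bounded_bilinear.continuous_on[OF bounded_bilinear_matrix_vector_mult] continuous_intros)

text \<open>The parallelogram law with the term of the difference dropped.\<close>

lemma power2_norm_add_le:
  fixes x y :: "'a::real_inner"
  shows "(norm (x + y))\<^sup>2 \<le> 2 * (norm x)\<^sup>2 + 2 * (norm y)\<^sup>2"
proof -
  have "(norm (x + y))\<^sup>2 + (norm (x - y))\<^sup>2 = 2 * (norm x)\<^sup>2 + 2 * (norm y)\<^sup>2"
    by (simp add: power2_norm_eq_inner inner_add inner_diff inner_commute)
  then show ?thesis by (metis le_add_same_cancel1 zero_le_power2)
qed

lemma nn_integral_power2_norm_add_le:
  fixes X Y :: "'w \<Rightarrow> 'a::euclidean_space"
  assumes "X \<in> borel_measurable N" "Y \<in> borel_measurable N"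
  shows "(\<integral>\<^sup>+\<omega>. ennreal ((norm (X \<omega> + Y \<omega>))\<^sup>2) \<partial>N)
    \<le> 2 * (\<integral>\<^sup>+\<omega>. ennreal ((norm (X \<omega>))\<^sup>2) \<partial>N) + 2 * (\<integral>\<^sup>+\<omega>. ennreal ((norm (Y \<omega>))\<^sup>2) \<partial>N)"
proof -
  note [measurable] = assms
  have "(\<integral>\<^sup>+\<omega>. ennreal ((norm (X \<omega> + Y \<omega>))\<^sup>2) \<partial>N)
    \<le> (\<integral>\<^sup>+\<omega>. 2 * ennreal ((norm (X \<omega>))\<^sup>2) + 2 * ennreal ((norm (Y \<omega>))\<^sup>2) \<partial>N)"
  proof (rule nn_integral_mono)
    fix \<omega>
    have "ennreal ((norm (X \<omega> + Y \<omega>))\<^sup>2) \<le> ennreal (2 * (norm (X \<omega>))\<^sup>2 + 2 * (norm (Y \<omega>))\<^sup>2)"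
      by (intro ennreal_leI power2_norm_add_le)
    then show "ennreal ((norm (X \<omega> + Y \<omega>))\<^sup>2) \<le> 2 * ennreal ((norm (X \<omega>))\<^sup>2) + 2 * ennreal ((norm (Y \<omega>))\<^sup>2)"
      by (simp add: ennreal_mult')
  qed
  then show ?thesis by (simp add: nn_integral_add nn_integral_cmult)
qed

definition square_integrable :: "'w measure \<Rightarrow> ('w \<Rightarrow> 'a::euclidean_space) \<Rightarrow> bool" where
  "square_integrable M X \<longleftrightarrow> X \<in> borel_measurable M \<and> integrable M (\<lambda>\<omega>. (norm (X \<omega>))\<^sup>2)"

lemma square_integrableD:
  assumes "square_integrable M X"
  shows "X \<in> borel_measurable M" "integrable M (\<lambda>\<omega>. (norm (X \<omega>))\<^sup>2)"
  using assms by (auto simp: square_integrable_def)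

lemma square_integrable_bound:
  fixes X :: "'w \<Rightarrow> 'a::euclidean_space" and Y :: "'w \<Rightarrow> 'b::euclidean_space"
  assumes X: "square_integrable M X" and Y: "Y \<in> borel_measurable M"
    and le: "\<And>\<omega>. \<omega> \<in> space M \<Longrightarrow> norm (Y \<omega>) \<le> C * norm (X \<omega>)"
  shows "square_integrable M Y"
  unfolding square_integrable_def
proof
  show "integrable M (\<lambda>\<omega>. (norm (Y \<omega>))\<^sup>2)"
  proof (rule Bochner_Integration.integrable_bound)
    show "integrable M (\<lambda>\<omega>. C\<^sup>2 * (norm (X \<omega>))\<^sup>2)"
      using square_integrableD(2)[OF X] by simp
    show "AE \<omega> in M. norm ((norm (Y \<omega>))\<^sup>2) \<le> norm (C\<^sup>2 * (norm (X \<omega>))\<^sup>2)"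
      using power_mono[OF le norm_ge_zero, of _ 2] by (intro AE_I2) (simp add: power_mult_distrib)
  qed (use Y in measurable)
qed fact

lemma square_integrable_add:
  assumes "square_integrable M X" "square_integrable M Y"
  shows "square_integrable M (\<lambda>\<omega>. X \<omega> + Y \<omega>)"
  unfolding square_integrable_def
proof
  note [measurable] = square_integrableD(1)[OF assms(1)] square_integrableD(1)[OF assms(2)]
  show "(\<lambda>\<omega>. X \<omega> + Y \<omega>) \<in> borel_measurable M" by measurable
  show "integrable M (\<lambda>\<omega>. (norm (X \<omega> + Y \<omega>))\<^sup>2)"
  proof (rule Bochner_Integration.integrable_bound)
    show "integrable M (\<lambda>\<omega>. 2 * (norm (X \<omega>))\<^sup>2 + 2 * (norm (Y \<omega>))\<^sup>2)"
      using assms square_integrableD(2) by fastforce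
    show "AE \<omega> in M. norm ((norm (X \<omega> + Y \<omega>))\<^sup>2) \<le> norm (2 * (norm (X \<omega>))\<^sup>2 + 2 * (norm (Y \<omega>))\<^sup>2)"
      using power2_norm_add_le by (auto intro!: AE_I2)
  qed measurable
qed

lemma square_integrable_scaleR:
  assumes "square_integrable M X"
  shows "square_integrable M (\<lambda>\<omega>. c *\<^sub>R X \<omega>)"
  using assms by (rule square_integrable_bound[where C = "\<bar>c\<bar>"])
    (use square_integrableD(1)[OF assms] in auto)

lemma square_integrable_diff:
  assumes "square_integrable M X" "square_integrable M Y"
  shows "square_integrable M (\<lambda>\<omega>. X \<omega> - Y \<omega>)"
  using square_integrable_add[OF assms(1) square_integrable_scaleR[OF assms(2), of "-1"]] by simp

text \<open>Polarisation: the inner product is a combination of three integrable squares.\<close>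

lemma square_integrable_inner:
  assumes "square_integrable M X" "square_integrable M Y"
  shows "integrable M (\<lambda>\<omega>. X \<omega> \<bullet> Y \<omega>)"
proof -
  note [measurable] = square_integrableD(1)[OF assms(1)] square_integrableD(1)[OF assms(2)]
  have "integrable M (\<lambda>\<omega>. ((norm (X \<omega> + Y \<omega>))\<^sup>2 - (norm (X \<omega>))\<^sup>2 - (norm (Y \<omega>))\<^sup>2) / 2)"
    using square_integrable_add[OF assms] assms
    by (intro integrable_divide Bochner_Integration.integrable_diff square_integrableD(2))
  then show ?thesis by (simp add: dot_norm)
qed

lemma square_integrable_nn_integral:
  assumes "X \<in> borel_measurable M"
  shows "square_integrable M X \<longleftrightarrow> (\<integral>\<^sup>+\<omega>. ennreal ((norm (X \<omega>))\<^sup>2) \<partial>M) < \<infinity>"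
  using assms unfolding square_integrable_def by (auto simp: integrable_iff_bounded)

text \<open>The second moment of \<open>x *\<^sub>R X \<omega> + Y \<omega>\<close> is a quadratic
  polynomial in \<open>x\<close> that is never negative.\<close>

lemma square_integrable_Cauchy_Schwarz:
  assumes "square_integrable M X" "square_integrable M Y"
  shows "\<bar>LINT \<omega>|M. X \<omega> \<bullet> Y \<omega>\<bar>
    \<le> sqrt (LINT \<omega>|M. (norm (X \<omega>))\<^sup>2) * sqrt (LINT \<omega>|M. (norm (Y \<omega>))\<^sup>2)"
proof -
  let ?a = "LINT \<omega>|M. (norm (X \<omega>))\<^sup>2" and ?b = "LINT \<omega>|M. X \<omega> \<bullet> Y \<omega>" and ?c = "LINT \<omega>|M. (norm (Y \<omega>))\<^sup>2"
  note int = square_integrableD(2)[OF assms(1)] square_integrableD(2)[OF assms(2)] square_integrable_inner[OF assms]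
  have q: "0 \<le> x\<^sup>2 * ?a + 2 * x * ?b + ?c" for x
  proof -
    have "0 \<le> (LINT \<omega>|M. (norm (x *\<^sub>R X \<omega> + Y \<omega>))\<^sup>2)" by simp
    also have "\<dots> = (LINT \<omega>|M. x\<^sup>2 * (norm (X \<omega>))\<^sup>2 + 2 * x * (X \<omega> \<bullet> Y \<omega>) + (norm (Y \<omega>))\<^sup>2)"
      by (intro Bochner_Integration.integral_cong) (simp_all add: power2_norm_eq_inner inner_add inner_commute power2_eq_square[of x] algebra_simps)
    also have "\<dots> = x\<^sup>2 * ?a + 2 * x * ?b + ?c"
      using int by simp
    finally show ?thesis .
  qed
  have nn: "0 \<le> ?a" "0 \<le> ?c" by simp_all
  have "?b\<^sup>2 \<le> ?a * ?c"
  proof (cases "?a = 0")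
    case True
    have "?b = 0"
    proof (rule ccontr)
      assume "?b \<noteq> 0"
      \<comment> \<open>With \<open>?a = 0\<close> the polynomial is affine, and at this point it
        takes the value -1.\<close>
      then show False using q[of "- (?c + 1) / (2 * ?b)"] True nn by (simp add: field_simps)
    qed
    then show ?thesis using nn by simp
  next
    case False
    then have "?a > 0" using nn(1) by linarith
    \<comment> \<open>The point is the minimiser of the quadratic.\<close>
    have "0 \<le> (- ?b / ?a)\<^sup>2 * ?a + 2 * (- ?b / ?a) * ?b + ?c" by (rule q)
    also have "\<dots> = ?c - ?b\<^sup>2 / ?a" using False by (simp add: field_simps power2_eq_square)
    finally show ?thesis using \<open>?a > 0\<close> by (simp add: field_simps)
  qed
  then show ?thesis
    by (metis real_sqrt_abs real_sqrt_le_mono real_sqrt_mult)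
qed

section \<open>Sums of bounded past matrices applied to Brownian increments\<close>

context brownian_motion begin

lemma W_increment_square_integrable:
  fixes s t :: real
  assumes st: "0 \<le> s" "s \<le> t"
  shows "square_integrable M (\<lambda>\<omega>. W t \<omega> - W s \<omega>)"
    and "expectation (\<lambda>\<omega>. (norm (W t \<omega> - W s \<omega>))\<^sup>2) = CARD('m) * (t - s)"
proof -
  have [measurable]: "W t \<in> borel_measurable M" "W s \<in> borel_measurable M"
    using W_measurable st by auto
  have eq: "(\<lambda>\<omega>. (norm (W t \<omega> - W s \<omega>))\<^sup>2) = (\<lambda>\<omega>. \<Sum>k\<in>UNIV. ((W t \<omega> - W s \<omega>) $ k)\<^sup>2)"
    by (simp add: norm_vec_def L2_set_def sum_nonneg)
  have "integrable M (\<lambda>\<omega>. (norm (W t \<omega> - W s \<omega>))\<^sup>2) \<and>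
    expectation (\<lambda>\<omega>. (norm (W t \<omega> - W s \<omega>))\<^sup>2) = CARD('m) * (t - s)"
  proof (cases "s = t")
    case False
    then have "s < t" using st by simp
    note mom = W_increment_component_moments[OF st(1) this]
    show ?thesis unfolding eq using mom(3,4)
      by (subst Bochner_Integration.integral_sum) (auto simp del: vector_minus_component)
  qed simp
  then show "square_integrable M (\<lambda>\<omega>. W t \<omega> - W s \<omega>)"
    "expectation (\<lambda>\<omega>. (norm (W t \<omega> - W s \<omega>))\<^sup>2) = CARD('m) * (t - s)"
    by (auto simp: square_integrable_def)
qed

text \<open>In each coordinate the expectation of the product factors by independence, and the
  increment is centred.\<close>

lemma W_increment_orthogonal:
  fixes s t :: real
  assumes st: "0 \<le> s" "s \<le> t" and Z: "Z \<in> borel_measurable (F s)" and sq: "square_integrable M Z"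
  shows "expectation (\<lambda>\<omega>. Z \<omega> \<bullet> (W t \<omega> - W s \<omega>)) = 0"
proof (cases "s = t")
  case False
  then have st': "s < t" using st by simp
  have Zk: "integrable M (\<lambda>\<omega>. Z \<omega> $ k)" for k
  proof -
    have "square_integrable M (\<lambda>\<omega>. Z \<omega> $ k)"
      using sq by (rule square_integrable_bound[where C=1])
        (use square_integrableD(1)[OF sq] in \<open>auto intro: component_le_norm_cart\<close>)
    then show ?thesis unfolding square_integrable_def
      by (auto intro: square_integrable_imp_integrable)
  qed
  have 1: "integrable M (\<lambda>\<omega>. Z \<omega> $ k * (W t \<omega> - W s \<omega>) $ k)
    \<and> expectation (\<lambda>\<omega>. Z \<omega> $ k * (W t \<omega> - W s \<omega>) $ k) = 0" for k
  proof -
    have ind: "indep_var borel (\<lambda>\<omega>. Z \<omega> $ k) borel (\<lambda>\<omega>. (W t \<omega> - W s \<omega>) $ k)"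
      using Z by (intro W_increment_indep_var[OF st(1) st', where h = "\<lambda>x. x $ k"]) auto
    show ?thesis
      using indep_var_integrable[OF ind] indep_var_lebesgue_integral[OF ind] Zk
        W_increment_component_moments[OF st(1) st', of k] by simp
  qed
  show ?thesis
    unfolding inner_vec_def inner_real_def using 1
    by (subst Bochner_Integration.integral_sum) (auto simp del: vector_minus_component)
qed simp

text \<open>The squared norms of \<open>A\<close> and of the increment are independent, so their
  product has the product expectation; the factor \<open>CARD('m)\<close> is the second moment of
  the increment per unit of time.\<close>

lemma W_increment_matrix:
  fixes s t :: real and A :: "'w \<Rightarrow> real^'m^'d"
  assumes st: "0 \<le> s" "s \<le> t" and A: "A \<in> borel_measurable (F s)"
    and bd: "\<And>\<omega>. \<omega> \<in> space M \<Longrightarrow> norm (A \<omega>) \<le> C"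
  shows "square_integrable M (\<lambda>\<omega>. A \<omega> *v (W t \<omega> - W s \<omega>))"
    and "expectation (\<lambda>\<omega>. (norm (A \<omega> *v (W t \<omega> - W s \<omega>)))\<^sup>2)
      \<le> CARD('m) * ((t - s) * expectation (\<lambda>\<omega>. (norm (A \<omega>))\<^sup>2))"
    and "\<And>G. G \<in> borel_measurable (F s) \<Longrightarrow> square_integrable M G \<Longrightarrow>
      expectation (\<lambda>\<omega>. G \<omega> \<bullet> (A \<omega> *v (W t \<omega> - W s \<omega>))) = 0"
proof -
  have [measurable]: "W t \<in> borel_measurable M" "W s \<in> borel_measurable M" "A \<in> borel_measurable M"
    using W_measurable st A F_measurableD by auto
  note dW = W_increment_square_integrable[OF st]
  have C: "norm (A \<omega>) \<le> \<bar>C\<bar>" if "\<omega> \<in> space M" for \<omega> using bd[OF that] by linarith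
  show sq: "square_integrable M (\<lambda>\<omega>. A \<omega> *v (W t \<omega> - W s \<omega>))"
    using dW(1)
  proof (rule square_integrable_bound[where C="\<bar>C\<bar>"])
    show "norm (A \<omega> *v (W t \<omega> - W s \<omega>)) \<le> \<bar>C\<bar> * norm (W t \<omega> - W s \<omega>)" if "\<omega> \<in> space M" for \<omega>
      using norm_matrix_vector_mult_le mult_right_mono[OF C[OF that] norm_ge_zero] by (rule order_trans)
  qed measurable
  show "expectation (\<lambda>\<omega>. (norm (A \<omega> *v (W t \<omega> - W s \<omega>)))\<^sup>2)
      \<le> CARD('m) * ((t - s) * expectation (\<lambda>\<omega>. (norm (A \<omega>))\<^sup>2))"
  proof (cases "s = t")
    case False
    then have st': "s < t" using st by simp
    have intA: "integrable M (\<lambda>\<omega>. (norm (A \<omega>))\<^sup>2)"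
      by (rule integrable_const_bound[where B = "C\<^sup>2"])
        (use power_mono[OF bd norm_ge_zero, of _ 2] in \<open>auto intro: AE_I2\<close>)
    have ind: "indep_var borel (\<lambda>\<omega>. (norm (A \<omega>))\<^sup>2) borel (\<lambda>\<omega>. (norm (W t \<omega> - W s \<omega>))\<^sup>2)"
      using A by (intro W_increment_indep_var[OF st(1) st', where h = "\<lambda>x. (norm x)\<^sup>2"]) auto
    have "expectation (\<lambda>\<omega>. (norm (A \<omega> *v (W t \<omega> - W s \<omega>)))\<^sup>2)
        \<le> expectation (\<lambda>\<omega>. (norm (A \<omega>))\<^sup>2 * (norm (W t \<omega> - W s \<omega>))\<^sup>2)"
    proof (rule integral_mono)
      show "integrable M (\<lambda>\<omega>. (norm (A \<omega>))\<^sup>2 * (norm (W t \<omega> - W s \<omega>))\<^sup>2)"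
        using indep_var_integrable[OF ind intA square_integrableD(2)[OF dW(1)]] .
      show "(norm (A \<omega> *v (W t \<omega> - W s \<omega>)))\<^sup>2 \<le> (norm (A \<omega>))\<^sup>2 * (norm (W t \<omega> - W s \<omega>))\<^sup>2" for \<omega>
        using power_mono[OF norm_matrix_vector_mult_le norm_ge_zero, of _ _ 2]
        by (simp add: power_mult_distrib)
    qed (rule square_integrableD(2)[OF sq])
    also have "\<dots> = expectation (\<lambda>\<omega>. (norm (A \<omega>))\<^sup>2) * (CARD('m) * (t - s))"
      using indep_var_lebesgue_integral[OF ind intA square_integrableD(2)[OF dW(1)]] dW(2) by simp
    finally show ?thesis by (simp add: algebra_simps)
  qed simp
  fix G :: "'w \<Rightarrow> real^'d" assume G: "G \<in> borel_measurable (F s)" and sqG: "square_integrable M G"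
  \<comment> \<open>This is the transpose of \<open>A\<close> applied to \<open>G\<close>. Moving
    the matrix to the past side of the inner product leaves the bare increment on the other;
    boundedness of \<open>A\<close> keeps \<open>?Z\<close> square integrable.\<close>
  let ?Z = "\<lambda>\<omega>. \<Sum>i\<in>UNIV. G \<omega> $ i *\<^sub>R A \<omega> $ i"
  have Z: "?Z \<in> borel_measurable (F s)" using A G by measurable
  have "square_integrable M ?Z" using sqG
  proof (rule square_integrable_bound[where C="CARD('d) * \<bar>C\<bar>"])
    show "?Z \<in> borel_measurable M" using Z F_measurableD st by blast
    fix \<omega> assume \<omega>: "\<omega> \<in> space M"
    have "norm (?Z \<omega>) \<le> (\<Sum>i\<in>(UNIV::'d set). norm (G \<omega>) * \<bar>C\<bar>)"
      using order_trans[OF Finite_Cartesian_Product.norm_nth_le C[OF \<omega>]]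
      by (intro sum_norm_le) (auto intro!: mult_mono component_le_norm_cart)
    then show "norm (?Z \<omega>) \<le> CARD('d) * \<bar>C\<bar> * norm (G \<omega>)" by (simp add: algebra_simps)
  qed
  from W_increment_orthogonal[OF st Z this]
  show "expectation (\<lambda>\<omega>. G \<omega> \<bullet> (A \<omega> *v (W t \<omega> - W s \<omega>))) = 0"
    by (simp add: inner_vec_def[of "G _"] matrix_vector_mul_component inner_sum_left)
qed

text \<open>Pythagoras for martingale differences: each new term is orthogonal to the partial sum
  before it, so second moments add. Orthogonality to \<open>G\<close> is inherited because
  \<open>s\<close> precedes every partition point.\<close>

lemma martingale_transform:
  fixes a :: "nat \<Rightarrow> real" and \<eta> :: "nat \<Rightarrow> 'w \<Rightarrow> real^'m^'d"
  assumes s: "0 \<le> s" "s \<le> a 0" and mono: "\<And>i. i < N \<Longrightarrow> a i \<le> a (Suc i)"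
    and \<eta>: "\<And>i. i < N \<Longrightarrow> \<eta> i \<in> borel_measurable (F (a i))"
    and bd: "\<And>i \<omega>. i < N \<Longrightarrow> \<omega> \<in> space M \<Longrightarrow> norm (\<eta> i \<omega>) \<le> C"
  defines "S \<equiv> \<lambda>n \<omega>. \<Sum>i<n. \<eta> i \<omega> *v (W (a (Suc i)) \<omega> - W (a i) \<omega>)"
  shows "square_integrable M (S N)"
    and "expectation (\<lambda>\<omega>. (norm (S N \<omega>))\<^sup>2)
      \<le> CARD('m) * (\<Sum>i<N. (a (Suc i) - a i) * expectation (\<lambda>\<omega>. (norm (\<eta> i \<omega>))\<^sup>2))"
    and "\<And>G. G \<in> borel_measurable (F s) \<Longrightarrow> square_integrable M G \<Longrightarrow>
      expectation (\<lambda>\<omega>. G \<omega> \<bullet> S N \<omega>) = 0"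
proof -
  have ord: "s \<le> a n" if "n \<le> N" for n
    using that s mono by (induction n) (auto intro: order_trans)
  let ?D = "\<lambda>i \<omega>. \<eta> i \<omega> *v (W (a (Suc i)) \<omega> - W (a i) \<omega>)"
  \<comment> \<open>Measurability with respect to \<open>F (a n)\<close> belongs to the induction:
    it lets the partial sum itself serve as the past variable in the orthogonality of the next
    term.\<close>
  have main: "S n \<in> borel_measurable (F (a n)) \<and> square_integrable M (S n) \<and>
    expectation (\<lambda>\<omega>. (norm (S n \<omega>))\<^sup>2)
      \<le> CARD('m) * (\<Sum>i<n. (a (Suc i) - a i) * expectation (\<lambda>\<omega>. (norm (\<eta> i \<omega>))\<^sup>2)) \<and>
    (\<forall>G. G \<in> borel_measurable (F s) \<longrightarrow> square_integrable M G \<longrightarrow>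
      expectation (\<lambda>\<omega>. G \<omega> \<bullet> S n \<omega>) = 0)" if "n \<le> N" for n
    using that
  proof (induction n)
    case 0
    then show ?case by (simp add: S_def square_integrable_def)
  next
    case (Suc n)
    then have n: "n < N" by simp
    have an: "0 \<le> a n" "a n \<le> a (Suc n)" "s \<le> a n" using ord[of n] n s mono by auto
    note inc = W_increment_matrix[OF an(1,2) \<eta>[OF n] bd[OF n]]
    have IH: "S n \<in> borel_measurable (F (a n))" "square_integrable M (S n)"
      "expectation (\<lambda>\<omega>. (norm (S n \<omega>))\<^sup>2)
      \<le> CARD('m) * (\<Sum>i<n. (a (Suc i) - a i) * expectation (\<lambda>\<omega>. (norm (\<eta> i \<omega>))\<^sup>2))"
      "\<And>G. G \<in> borel_measurable (F s) \<Longrightarrow> square_integrable M G \<Longrightarrow> expectation (\<lambda>\<omega>. G \<omega> \<bullet> S n \<omega>) = 0"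
      using Suc by auto
    have SSuc: "S (Suc n) = (\<lambda>\<omega>. S n \<omega> + ?D n \<omega>)" by (simp add: S_def fun_eq_iff)
    have [measurable]: "S n \<in> borel_measurable (F (a (Suc n)))" "\<eta> n \<in> borel_measurable (F (a (Suc n)))"
      "W (a (Suc n)) \<in> borel_measurable (F (a (Suc n)))" "W (a n) \<in> borel_measurable (F (a (Suc n)))"
      using F_measurable_mono[OF an(1,2)] IH(1) \<eta>[OF n] W_adapted an by auto
    have meas: "S (Suc n) \<in> borel_measurable (F (a (Suc n)))"
      unfolding SSuc by measurable
    have orth: "expectation (\<lambda>\<omega>. S n \<omega> \<bullet> ?D n \<omega>) = 0"
      using inc(3)[OF _ IH(1,2)] by simp
    have "expectation (\<lambda>\<omega>. (norm (S (Suc n) \<omega>))\<^sup>2)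
        = expectation (\<lambda>\<omega>. (norm (S n \<omega>))\<^sup>2 + 2 * (S n \<omega> \<bullet> ?D n \<omega>) + (norm (?D n \<omega>))\<^sup>2)"
      unfolding SSuc by (simp add: power2_norm_eq_inner inner_add inner_commute add_ac)
    also have "\<dots> = expectation (\<lambda>\<omega>. (norm (S n \<omega>))\<^sup>2) + expectation (\<lambda>\<omega>. (norm (?D n \<omega>))\<^sup>2)"
      using IH(2) inc(1) square_integrable_inner[OF IH(2) inc(1)] orth
      by (simp add: square_integrableD)
    also have "\<dots> \<le> CARD('m) * (\<Sum>i<Suc n. (a (Suc i) - a i) * expectation (\<lambda>\<omega>. (norm (\<eta> i \<omega>))\<^sup>2))"
      using IH(3) inc(2) by (simp add: distrib_left)
    finally have b: "expectation (\<lambda>\<omega>. (norm (S (Suc n) \<omega>))\<^sup>2)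
       \<le> CARD('m) * (\<Sum>i<Suc n. (a (Suc i) - a i) * expectation (\<lambda>\<omega>. (norm (\<eta> i \<omega>))\<^sup>2))" .
    have "expectation (\<lambda>\<omega>. G \<omega> \<bullet> S (Suc n) \<omega>) = 0"
      if G: "G \<in> borel_measurable (F s)" "square_integrable M G" for G
      unfolding SSuc inner_add_right
      using IH(4)[OF G] inc(3)[OF _ F_measurable_mono[OF s(1) an(3) G(1)] G(2)]
        square_integrable_inner[OF G(2) IH(2)] square_integrable_inner[OF G(2) inc(1)]
      by simp
    then show ?case using meas b square_integrable_add[OF IH(2) inc(1)] unfolding SSuc[symmetric] by blast
  qed
  from main[of N] show "square_integrable M (S N)" and "expectation (\<lambda>\<omega>. (norm (S N \<omega>))\<^sup>2)
      \<le> CARD('m) * (\<Sum>i<N. (a (Suc i) - a i) * expectation (\<lambda>\<omega>. (norm (\<eta> i \<omega>))\<^sup>2))"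
    and "\<And>G. G \<in> borel_measurable (F s) \<Longrightarrow> square_integrable M G \<Longrightarrow>
      expectation (\<lambda>\<omega>. G \<omega> \<bullet> S N \<omega>) = 0"
    by simp_all
qed

end

section \<open>Increments of Ito integrals: simple integrands, then the mean-square limit\<close>

text \<open>The half-open intervals are disjoint, so at most one summand is nonzero and the square
  passes into the sum.\<close>

lemma power2_norm_simple_value:
  assumes "\<And>i. i < N \<Longrightarrow> \<tau> i \<le> \<tau> (Suc i)"
  shows "(norm (simple_value N \<tau> \<xi> r \<omega>))\<^sup>2
    = (\<Sum>i<N. indicator {\<tau> i<..\<tau> (Suc i)} r * (norm (\<xi> i \<omega>))\<^sup>2)"
  using assms
proof (induction N)
  case 0
  then show ?case by (simp add: simple_value_def)
next
  case (Suc N)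
  have mono: "\<tau> i \<le> \<tau> N" if "i \<le> N" for i
    using that by (induction rule: inc_induct) (use Suc.prems less_SucI order_trans in blast)+
  show ?case
  proof (cases "r \<in> {\<tau> N<..\<tau> (Suc N)}")
    case True
    have "r \<notin> {\<tau> i<..\<tau> (Suc i)}" if "i < N" for i
      using mono[of "Suc i"] that True by auto
    then show ?thesis using True by (simp add: simple_value_def)
  next
    case False
    then show ?thesis using Suc by (simp add: simple_value_def)
  qed
qed

context brownian_motion begin

text \<open>Clipping the partition to \<open>[s, t]\<close> turns the increment of the integral into
  a single martingale transform that starts at \<open>s\<close> or later.\<close>

lemma ito_simple_integral_increment:
  fixes \<xi> :: "nat \<Rightarrow> 'w \<Rightarrow> real^'m^'d"
  assumes simple: "simple_integrand M F N \<tau> \<xi>" and st: "0 \<le> s" "s \<le> t"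
  defines "J \<equiv> \<lambda>\<omega>. ito_simple_integral W N \<tau> \<xi> t \<omega> - ito_simple_integral W N \<tau> \<xi> s \<omega>"
  shows "square_integrable M J"
    and "(\<integral>\<^sup>+\<omega>. ennreal ((norm (J \<omega>))\<^sup>2) \<partial>M)
      \<le> CARD('m) * (\<integral>\<^sup>+\<omega>. (\<integral>\<^sup>+r\<in>{s<..t}. ennreal ((norm (simple_value N \<tau> \<xi> r \<omega>))\<^sup>2) \<partial>lborel) \<partial>M)"
    and "\<And>G. G \<in> borel_measurable (F s) \<Longrightarrow> square_integrable M G \<Longrightarrow>
      expectation (\<lambda>\<omega>. G \<omega> \<bullet> J \<omega>) = 0"
proof -
  define a where "a i = max s (min t (\<tau> i))" for i
  \<comment> \<open>If \<open>\<tau> i\<close> is beyond \<open>t\<close>, clipping moves the point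
    back to \<open>t\<close>, where \<open>\<xi> i\<close> may not be known yet. The clipped
    increment is then zero, so the coefficient can be replaced by 0.\<close>
  define \<eta> where "\<eta> i \<omega> = (if \<tau> i < t then \<xi> i \<omega> else 0)" for i \<omega>
  have \<tau>: "0 \<le> \<tau> 0" "\<And>i. i < N \<Longrightarrow> \<tau> i \<le> \<tau> (Suc i)"
    and \<xi>: "\<And>i. i < N \<Longrightarrow> \<xi> i \<in> borel_measurable (F (\<tau> i))"
    using simple by (auto simp: simple_integrand_def)
  obtain C where C: "\<And>i \<omega>. i < N \<Longrightarrow> \<omega> \<in> space M \<Longrightarrow> norm (\<xi> i \<omega>) \<le> C"
    using simple unfolding simple_integrand_def frobenius_norm_eq_norm by blast
  have \<tau>0: "0 \<le> \<tau> i" if "i \<le> N" for i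
    using that \<tau> by (induction i) (auto intro: order_trans)
  have a_mono: "a i \<le> a (Suc i)" if "i < N" for i
    using \<tau>(2)[OF that] by (auto simp: a_def)
  have \<eta>: "\<eta> i \<in> borel_measurable (F (a i))" if "i < N" for i
  proof (cases "\<tau> i < t")
    case True
    then have "\<tau> i \<le> a i" "\<eta> i = \<xi> i" by (auto simp: a_def \<eta>_def)
    then show ?thesis using F_measurable_mono[OF \<tau>0 _ \<xi>] that by simp
  next
    case False
    then have "\<eta> i = (\<lambda>_. 0)" by (auto simp: \<eta>_def)
    then show ?thesis by simp
  qed
  have \<eta>bd: "norm (\<eta> i \<omega>) \<le> \<bar>C\<bar>" if "i < N" "\<omega> \<in> space M" for i \<omega>
    using C[OF that] by (auto simp: \<eta>_def)
  have J: "J = (\<lambda>\<omega>. \<Sum>i<N. \<eta> i \<omega> *v (W (a (Suc i)) \<omega> - W (a i) \<omega>))"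
    unfolding J_def ito_simple_integral_def sum_subtractf[symmetric]
      matrix_vector_mult_diff_distrib[symmetric]
  proof (intro ext sum.cong refl)
    fix i \<omega> assume "i \<in> {..<N}"
    then have le: "\<tau> i \<le> \<tau> (Suc i)" using \<tau> by simp
    \<comment> \<open>Differences of stopped values are values at the clipped time, up to
      \<open>W s \<omega>\<close>, which cancels between consecutive partition points.\<close>
    have c: "W (min t x) \<omega> - W (min s x) \<omega> = W (max s (min t x)) \<omega> - W s \<omega>" for x
      using st by (auto simp: min_def max_def)
    have "W (min t (\<tau> (Suc i))) \<omega> - W (min t (\<tau> i)) \<omega> - (W (min s (\<tau> (Suc i))) \<omega> - W (min s (\<tau> i)) \<omega>)
      = (W (min t (\<tau> (Suc i))) \<omega> - W (min s (\<tau> (Suc i))) \<omega>) - (W (min t (\<tau> i)) \<omega> - W (min s (\<tau> i)) \<omega>)"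
      by (simp add: algebra_simps)
    also have "\<dots> = W (a (Suc i)) \<omega> - W (a i) \<omega>"
      unfolding c a_def by simp
    finally have "W (min t (\<tau> (Suc i))) \<omega> - W (min t (\<tau> i)) \<omega> - (W (min s (\<tau> (Suc i))) \<omega> - W (min s (\<tau> i)) \<omega>)
      = W (a (Suc i)) \<omega> - W (a i) \<omega>" .
    moreover have "W (a (Suc i)) \<omega> - W (a i) \<omega> = 0" if "\<not> \<tau> i < t"
      using that le by (simp add: a_def min_def)
    ultimately show "\<xi> i \<omega> *v (W (min t (\<tau> (Suc i))) \<omega> - W (min t (\<tau> i)) \<omega> - (W (min s (\<tau> (Suc i))) \<omega> - W (min s (\<tau> i)) \<omega>))
      = \<eta> i \<omega> *v (W (a (Suc i)) \<omega> - W (a i) \<omega>)"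
      by (auto simp: \<eta>_def)
  qed
  have sa: "s \<le> a 0" by (simp add: a_def)
  note mt = martingale_transform[where a=a and \<eta>=\<eta> and N=N, OF st(1) sa a_mono \<eta> \<eta>bd]
  show sq: "square_integrable M J" unfolding J by (rule mt(1))
  show "\<And>G. G \<in> borel_measurable (F s) \<Longrightarrow> square_integrable M G \<Longrightarrow> expectation (\<lambda>\<omega>. G \<omega> \<bullet> J \<omega>) = 0"
    unfolding J by (rule mt(3))
  have [measurable]: "\<eta> i \<in> borel_measurable M" if "i < N" for i
    using F_measurableD[OF _ \<eta>[OF that]] st by (simp add: a_def)
  have int\<eta>: "integrable M (\<lambda>\<omega>. (norm (\<eta> i \<omega>))\<^sup>2)" if "i < N" for i
    by (rule integrable_const_bound[where B = "C\<^sup>2"])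
      (use power_mono[OF \<eta>bd norm_ge_zero, of i _ 2] that in \<open>auto intro: AE_I2\<close>)
  \<comment> \<open>A clipped interval lies in \<open>{s<..t}\<close> and in the original interval;
    where they differ, the left side is zero.\<close>
  have sub: "indicator {a i<..a (Suc i)} r * (norm (\<eta> i \<omega>))\<^sup>2
      \<le> indicator {s<..t} r * (indicator {\<tau> i<..\<tau> (Suc i)} r * (norm (\<xi> i \<omega>))\<^sup>2)" for i r \<omega>
    by (auto simp: indicator_def a_def \<eta>_def)
  have inner: "(\<integral>\<^sup>+r. ennreal (indicator {a i<..a (Suc i)} r * (norm (\<eta> i \<omega>))\<^sup>2) \<partial>lborel)
      = ennreal (a (Suc i) - a i) * ennreal ((norm (\<eta> i \<omega>))\<^sup>2)" if "i < N" for i \<omega>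
    using a_mono[OF that] by (simp add: ennreal_mult' ennreal_indicator nn_integral_multc)
  have "(\<integral>\<^sup>+\<omega>. ennreal ((norm (J \<omega>))\<^sup>2) \<partial>M) = ennreal (expectation (\<lambda>\<omega>. (norm (J \<omega>))\<^sup>2))"
    using square_integrableD(2)[OF sq] by (intro nn_integral_eq_integral) auto
  also have "\<dots> \<le> ennreal (CARD('m) * (\<Sum>i<N. (a (Suc i) - a i) * expectation (\<lambda>\<omega>. (norm (\<eta> i \<omega>))\<^sup>2)))"
    unfolding J by (intro ennreal_leI mt(2))
  also have "\<dots> = CARD('m) * (\<Sum>i<N. ennreal (a (Suc i) - a i) * (\<integral>\<^sup>+\<omega>. ennreal ((norm (\<eta> i \<omega>))\<^sup>2) \<partial>M))"
  proof -
    have "ennreal (\<Sum>i<N. (a (Suc i) - a i) * expectation (\<lambda>\<omega>. (norm (\<eta> i \<omega>))\<^sup>2))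
      = (\<Sum>i<N. ennreal (a (Suc i) - a i) * ennreal (expectation (\<lambda>\<omega>. (norm (\<eta> i \<omega>))\<^sup>2)))"
      using a_mono by (subst sum_ennreal[symmetric]) (auto intro!: sum.cong ennreal_mult mult_nonneg_nonneg)
    then show ?thesis
      using int\<eta> by (simp add: ennreal_mult' ennreal_of_nat_eq_real_of_nat nn_integral_eq_integral)
  qed
  also have "(\<Sum>i<N. ennreal (a (Suc i) - a i) * (\<integral>\<^sup>+\<omega>. ennreal ((norm (\<eta> i \<omega>))\<^sup>2) \<partial>M))
    = (\<Sum>i<N. \<integral>\<^sup>+\<omega>. (\<integral>\<^sup>+r. ennreal (indicator {a i<..a (Suc i)} r * (norm (\<eta> i \<omega>))\<^sup>2) \<partial>lborel) \<partial>M)"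
    by (intro sum.cong refl) (simp add: inner nn_integral_cmult)
  also have "\<dots> = (\<integral>\<^sup>+\<omega>. (\<Sum>i<N. \<integral>\<^sup>+r. ennreal (indicator {a i<..a (Suc i)} r * (norm (\<eta> i \<omega>))\<^sup>2) \<partial>lborel) \<partial>M)"
    by (rule nn_integral_sum[symmetric]) (simp add: inner)
  also have "\<dots> = (\<integral>\<^sup>+\<omega>. (\<integral>\<^sup>+r. (\<Sum>i<N. ennreal (indicator {a i<..a (Suc i)} r * (norm (\<eta> i \<omega>))\<^sup>2)) \<partial>lborel) \<partial>M)"
    by (intro nn_integral_cong nn_integral_sum[symmetric]) measurable
  also have "\<dots> \<le> (\<integral>\<^sup>+\<omega>. (\<integral>\<^sup>+r\<in>{s<..t}. ennreal ((norm (simple_value N \<tau> \<xi> r \<omega>))\<^sup>2) \<partial>lborel) \<partial>M)"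
  proof (intro nn_integral_mono)
    fix \<omega> and r :: real
    have "(\<Sum>i<N. ennreal (indicator {a i<..a (Suc i)} r * (norm (\<eta> i \<omega>))\<^sup>2))
      \<le> ennreal (indicator {s<..t} r * (\<Sum>i<N. indicator {\<tau> i<..\<tau> (Suc i)} r * (norm (\<xi> i \<omega>))\<^sup>2))"
      unfolding sum_distrib_left by (subst sum_ennreal, simp) (intro ennreal_leI sum_mono sub)
    then show "(\<Sum>i<N. ennreal (indicator {a i<..a (Suc i)} r * (norm (\<eta> i \<omega>))\<^sup>2))
      \<le> ennreal ((norm (simple_value N \<tau> \<xi> r \<omega>))\<^sup>2) * indicator {s<..t} r"
      by (simp add: power2_norm_simple_value[of N \<tau>, OF \<tau>(2)] ennreal_mult' ennreal_indicator mult.commute)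
  qed
  finally show "(\<integral>\<^sup>+\<omega>. ennreal ((norm (J \<omega>))\<^sup>2) \<partial>M)
      \<le> CARD('m) * (\<integral>\<^sup>+\<omega>. (\<integral>\<^sup>+r\<in>{s<..t}. ennreal ((norm (simple_value N \<tau> \<xi> r \<omega>))\<^sup>2) \<partial>lborel) \<partial>M)"
    by (simp add: mult_left_mono)
qed

text \<open>Progressive measurability concerns a restricted time interval only. Composing with the
  clipping of time gives joint measurability on the full product, the form in which iterated
  integrals can be split.\<close>

lemma prog_measurable_upto_clip:
  assumes X: "prog_measurable_upto F T X" and T: "0 \<le> T"
  shows "(\<lambda>p. X (max 0 (min T (fst p))) (snd p)) \<in> borel_measurable (borel \<Otimes>\<^sub>M M)"
proof -
  have f: "(\<lambda>p. (max 0 (min T (fst p)), snd p)) \<in> borel \<Otimes>\<^sub>M M \<rightarrow>\<^sub>M restrict_space borel {0..T} \<Otimes>\<^sub>M F T"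
  proof (rule measurable_Pair)
    show "(\<lambda>p. max 0 (min T (fst p))) \<in> borel \<Otimes>\<^sub>M M \<rightarrow>\<^sub>M restrict_space borel {0..T}"
      using T by (intro measurable_restrict_space2) auto
    have "(\<lambda>\<omega>. \<omega>) \<in> M \<rightarrow>\<^sub>M F T"
      by (rule F_measurableD[OF T]) simp
    then show "(\<lambda>p. snd p) \<in> borel \<Otimes>\<^sub>M M \<rightarrow>\<^sub>M F T"
      by (rule measurable_compose[OF measurable_snd])
  qed
  have g: "(\<lambda>(s, \<omega>). X s \<omega>) \<in> borel_measurable (restrict_space borel {0..T} \<Otimes>\<^sub>M F T)"
    using X T by (auto simp: prog_measurable_upto_def)
  show ?thesis using measurable_compose[OF f g] by simp
qed

lemma prog_measurable_upto_adapted: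
  assumes X: "prog_measurable_upto F T X" and T: "0 \<le> T"
  shows "X T \<in> borel_measurable (F T)"
proof -
  have f: "(\<lambda>\<omega>. (T, \<omega>)) \<in> F T \<rightarrow>\<^sub>M restrict_space borel {0..T} \<Otimes>\<^sub>M F T"
    using T by (intro measurable_Pair) (auto simp: space_restrict_space)
  have g: "(\<lambda>(s, \<omega>). X s \<omega>) \<in> borel_measurable (restrict_space borel {0..T} \<Otimes>\<^sub>M F T)"
    using X T by (auto simp: prog_measurable_upto_def)
  show ?thesis using measurable_compose[OF f g] by simp
qed

text \<open>Both facts survive the mean-square limit: the bound by splitting off the approximation
  errors, the orthogonality by Cauchy-Schwarz. The deterministic envelope \<open>h\<close> makes the
  right side an integral over time alone. Only past-measurability of \<open>G\<close> is involved,
  never that of \<open>I\<close>.\<close>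

lemma ito_integral_increment:
  fixes H :: "real \<Rightarrow> 'w \<Rightarrow> real^'m^'d" and h :: "real \<Rightarrow> real"
  assumes ito: "ito_integral M F W H I" and st: "0 \<le> s" "s \<le> t"
    and h: "h \<in> borel_measurable borel"
    and H_le: "\<And>r \<omega>. r \<in> {s<..t} \<Longrightarrow> \<omega> \<in> space M \<Longrightarrow> norm (H r \<omega>) \<le> h r"
    and h_fin: "(\<integral>\<^sup>+r\<in>{s<..t}. ennreal ((h r)\<^sup>2) \<partial>lborel) < \<infinity>"
  shows "square_integrable M (\<lambda>\<omega>. I t \<omega> - I s \<omega>)"
    and "(\<integral>\<^sup>+\<omega>. ennreal ((norm (I t \<omega> - I s \<omega>))\<^sup>2) \<partial>M)
      \<le> of_nat (4 * CARD('m)) * (\<integral>\<^sup>+r\<in>{s<..t}. ennreal ((h r)\<^sup>2) \<partial>lborel)"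
    and "\<And>G. G \<in> borel_measurable (F s) \<Longrightarrow> square_integrable M G \<Longrightarrow>
      expectation (\<lambda>\<omega>. G \<omega> \<bullet> (I t \<omega> - I s \<omega>)) = 0"
proof -
  have t: "0 \<le> t" using st by simp
  let ?J = "\<lambda>\<omega>. I t \<omega> - I s \<omega>" and ?h = "\<integral>\<^sup>+r\<in>{s<..t}. ennreal ((h r)\<^sup>2) \<partial>lborel"
  obtain N \<tau> \<xi> where simple: "\<And>n. simple_integrand M F (N n) (\<tau> n) (\<xi> n)"
    and H_lim: "(\<lambda>n. \<integral>\<^sup>+\<omega>. (\<integral>\<^sup>+s\<in>{0..t}. ennreal
             ((frobenius_norm (simple_value (N n) (\<tau> n) (\<xi> n) s \<omega> - H s \<omega>))\<^sup>2) \<partial>lborel) \<partial>M)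
            \<longlonglongrightarrow> 0"
    and I_lim: "\<And>T. 0 \<le> T \<Longrightarrow> (\<lambda>n. \<integral>\<^sup>+\<omega>. ennreal
             ((norm (ito_simple_integral W (N n) (\<tau> n) (\<xi> n) T \<omega> - I T \<omega>))\<^sup>2) \<partial>M)
            \<longlonglongrightarrow> 0"
    using ito t unfolding ito_integral_def by blast
  have I_meas: "\<And>T. 0 \<le> T \<Longrightarrow> I T \<in> borel_measurable M" and H_prog: "prog_measurable_upto F t H"
    using ito t by (auto simp: ito_integral_def)
  define A where "A n T \<omega> = ito_simple_integral W (N n) (\<tau> n) (\<xi> n) T \<omega>" for n T \<omega>
  define V where "V n r \<omega> = simple_value (N n) (\<tau> n) (\<xi> n) r \<omega>" for n r \<omega>
  define \<epsilon> where "\<epsilon> n = (\<integral>\<^sup>+\<omega>. (\<integral>\<^sup>+r\<in>{0..t}. ennreal ((norm (V n r \<omega> - H r \<omega>))\<^sup>2) \<partial>lborel) \<partial>M)" for n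
  define e where "e n T = (\<integral>\<^sup>+\<omega>. ennreal ((norm (A n T \<omega> - I T \<omega>))\<^sup>2) \<partial>M)" for n T
  define J where "J n \<omega> = A n t \<omega> - A n s \<omega>" for n \<omega>
  have \<epsilon>: "\<epsilon> \<longlonglongrightarrow> 0" using H_lim by (simp add: \<epsilon>_def[abs_def] V_def frobenius_norm_eq_norm)
  have e: "(\<lambda>n. e n T) \<longlonglongrightarrow> 0" if "0 \<le> T" for T using I_lim[OF that] by (simp add: e_def A_def)
  have \<tau>0: "0 \<le> \<tau> n i" if "i \<le> N n" for n i
    using that simple[of n] by (induction i) (auto simp: simple_integrand_def intro: order_trans)
  have \<xi>[measurable]: "\<xi> n i \<in> borel_measurable M" if "i < N n" for n i
    using that simple[of n] by (intro F_measurableD[OF \<tau>0[of i n]]) (auto simp: simple_integrand_def)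
  have [measurable]: "W (min T (\<tau> n i)) \<in> borel_measurable M" if "0 \<le> T" "i \<le> N n" for T n i
    using W_measurable \<tau>0 that by simp
  have A_meas: "A n T \<in> borel_measurable M" if "0 \<le> T" for n T
    unfolding A_def ito_simple_integral_def using that by measurable
  note [measurable] = A_meas[OF t] A_meas[OF st(1)] I_meas[OF t] I_meas[OF st(1)]
  note inc = ito_simple_integral_increment[OF simple st, folded A_def, folded J_def V_def]
  have J_meas[measurable]: "J n \<in> borel_measurable M" for n unfolding J_def by measurable
  define d where "d n = (\<integral>\<^sup>+\<omega>. ennreal ((norm (?J \<omega> - J n \<omega>))\<^sup>2) \<partial>M)" for n
  have d_le: "d n \<le> 2 * e n t + 2 * e n s" for n
  proof -
    have "d n = (\<integral>\<^sup>+\<omega>. ennreal ((norm ((A n s \<omega> - I s \<omega>) + - (A n t \<omega> - I t \<omega>)))\<^sup>2) \<partial>M)"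
      unfolding d_def J_def by (simp add: algebra_simps)
    also have "\<dots> \<le> 2 * e n s + 2 * e n t"
      unfolding e_def by (rule order_trans[OF nn_integral_power2_norm_add_le]) (auto simp: norm_minus_commute)
    finally show ?thesis by (simp add: add.commute)
  qed
  have "(\<lambda>n. 2 * e n t + 2 * e n s) \<longlonglongrightarrow> 2 * 0 + 2 * 0"
    by (intro tendsto_add ennreal_tendsto_cmult e t st(1)) auto
  then have "(\<lambda>n. 2 * e n t + 2 * e n s) \<longlonglongrightarrow> 0" by simp
  then have d: "d \<longlonglongrightarrow> 0"
    by (rule tendsto_sandwich[OF _ _ tendsto_const, rotated 2]) (auto simp: d_le)
  have Hclip: "(\<lambda>p. H (max 0 (min t (fst p))) (snd p)) \<in> borel_measurable (borel \<Otimes>\<^sub>M M)"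
    using prog_measurable_upto_clip[OF H_prog t] .
  have V_le: "(\<integral>\<^sup>+\<omega>. (\<integral>\<^sup>+r\<in>{s<..t}. ennreal ((norm (V n r \<omega>))\<^sup>2) \<partial>lborel) \<partial>M) \<le> 2 * ?h + 2 * \<epsilon> n" for n
  proof -
    \<comment> \<open>On the support of the indicator the clipping is the identity, so
      \<open>?E\<close> integrates to \<open>\<epsilon> n\<close>; the clipped form is jointly
      measurable.\<close>
    let ?E = "\<lambda>r \<omega>. ennreal ((norm (V n r \<omega> - H (max 0 (min t r)) \<omega>))\<^sup>2) * indicator {0..t} r"
    have "(\<lambda>p. V n (snd p) (fst p)) \<in> borel_measurable (M \<Otimes>\<^sub>M lborel)"
      unfolding V_def simple_value_def by measurable
    moreover have "(\<lambda>p. H (max 0 (min t (snd p))) (fst p)) \<in> borel_measurable (M \<Otimes>\<^sub>M lborel)"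
      using measurable_compose[OF measurable_pair_swap' Hclip]
      by (simp add: case_prod_beta cong: measurable_cong_sets)
    ultimately have E[measurable]: "(\<lambda>p. ?E (snd p) (fst p)) \<in> borel_measurable (M \<Otimes>\<^sub>M lborel)"
      by measurable
    have E1: "(\<lambda>r. ?E r \<omega>) \<in> borel_measurable lborel" if "\<omega> \<in> space M" for \<omega>
      using measurable_compose[OF measurable_Pair1' E, OF that] by simp
    have E2: "(\<lambda>\<omega>. \<integral>\<^sup>+r. ?E r \<omega> \<partial>lborel) \<in> borel_measurable M"
      using lborel.borel_measurable_nn_integral[of "\<lambda>\<omega> r. ?E r \<omega>" M] E
      by (simp add: case_prod_beta)
    have "(\<integral>\<^sup>+\<omega>. (\<integral>\<^sup>+r\<in>{s<..t}. ennreal ((norm (V n r \<omega>))\<^sup>2) \<partial>lborel) \<partial>M)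
        \<le> (\<integral>\<^sup>+\<omega>. (\<integral>\<^sup>+r. 2 * (ennreal ((h r)\<^sup>2) * indicator {s<..t} r) + 2 * ?E r \<omega> \<partial>lborel) \<partial>M)"
    proof (intro nn_integral_mono)
      fix \<omega> and r :: real assume \<omega>: "\<omega> \<in> space M"
      show "ennreal ((norm (V n r \<omega>))\<^sup>2) * indicator {s<..t} r
          \<le> 2 * (ennreal ((h r)\<^sup>2) * indicator {s<..t} r) + 2 * ?E r \<omega>"
      proof (cases "r \<in> {s<..t}")
        case True
        then have r: "max 0 (min t r) = r" "r \<in> {0..t}" using st by auto
        have "(norm (V n r \<omega>))\<^sup>2 \<le> 2 * (norm (H r \<omega>))\<^sup>2 + 2 * (norm (V n r \<omega> - H r \<omega>))\<^sup>2"
          using power2_norm_add_le[of "H r \<omega>" "V n r \<omega> - H r \<omega>"] by simp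
        also have "\<dots> \<le> 2 * (h r)\<^sup>2 + 2 * (norm (V n r \<omega> - H r \<omega>))\<^sup>2"
          using power_mono[OF H_le[OF True \<omega>] norm_ge_zero, of 2] by simp
        finally have "ennreal ((norm (V n r \<omega>))\<^sup>2) \<le> ennreal (2 * (h r)\<^sup>2 + 2 * (norm (V n r \<omega> - H r \<omega>))\<^sup>2)"
          by (rule ennreal_leI)
        then show ?thesis using True r by (simp add: ennreal_mult')
      qed simp
    qed
    also have "\<dots> = (\<integral>\<^sup>+\<omega>. 2 * ?h + 2 * (\<integral>\<^sup>+r. ?E r \<omega> \<partial>lborel) \<partial>M)"
      using E1 h by (intro nn_integral_cong) (simp add: nn_integral_add nn_integral_cmult)
    also have "\<dots> = 2 * ?h + 2 * (\<integral>\<^sup>+\<omega>. (\<integral>\<^sup>+r. ?E r \<omega> \<partial>lborel) \<partial>M)"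
      using E2 by (simp add: nn_integral_add nn_integral_cmult emeasure_space_1)
    also have "(\<integral>\<^sup>+\<omega>. (\<integral>\<^sup>+r. ?E r \<omega> \<partial>lborel) \<partial>M) = \<epsilon> n"
      unfolding \<epsilon>_def by (intro nn_integral_cong) (auto simp: indicator_def)
    finally show ?thesis .
  qed
  \<comment> \<open>The factor 4 is 2 * 2: one 2 from comparing \<open>?J\<close> with
    \<open>J n\<close>, the other from comparing \<open>V n\<close> with \<open>H\<close>.\<close>
  have J_le: "(\<integral>\<^sup>+\<omega>. ennreal ((norm (?J \<omega>))\<^sup>2) \<partial>M) \<le> of_nat (4 * CARD('m)) * ?h + (of_nat (4 * CARD('m)) * \<epsilon> n + 2 * d n)" for n
  proof -
    have "(\<integral>\<^sup>+\<omega>. ennreal ((norm (?J \<omega>))\<^sup>2) \<partial>M) = (\<integral>\<^sup>+\<omega>. ennreal ((norm (J n \<omega> + (?J \<omega> - J n \<omega>)))\<^sup>2) \<partial>M)"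
      by simp
    also have "\<dots> \<le> 2 * (\<integral>\<^sup>+\<omega>. ennreal ((norm (J n \<omega>))\<^sup>2) \<partial>M) + 2 * d n"
      unfolding d_def by (rule nn_integral_power2_norm_add_le) measurable
    also have "\<dots> \<le> 2 * (CARD('m) * (2 * ?h + 2 * \<epsilon> n)) + 2 * d n"
      by (intro add_mono mult_left_mono order_trans[OF inc(2)] V_le order_refl) auto
    also have "\<dots> = of_nat (4 * CARD('m)) * ?h + (of_nat (4 * CARD('m)) * \<epsilon> n + 2 * d n)"
      by (simp add: distrib_left mult_ac add_ac)
    finally show ?thesis .
  qed
  have 1: "(\<lambda>n. of_nat (4 * CARD('m)) * \<epsilon> n) \<longlonglongrightarrow> of_nat (4 * CARD('m)) * 0"
    by (rule ennreal_tendsto_cmult[OF _ \<epsilon>]) (rule of_nat_less_top)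
  have 2: "(\<lambda>n. 2 * d n) \<longlonglongrightarrow> 2 * 0"
    by (rule ennreal_tendsto_cmult[OF _ d]) simp
  from tendsto_add[OF tendsto_const tendsto_add[OF 1 2], of "of_nat (4 * CARD('m)) * ?h"]
  have "(\<lambda>n. of_nat (4 * CARD('m)) * ?h + (of_nat (4 * CARD('m)) * \<epsilon> n + 2 * d n)) \<longlonglongrightarrow> of_nat (4 * CARD('m)) * ?h"
    by simp
  then show le: "(\<integral>\<^sup>+\<omega>. ennreal ((norm (?J \<omega>))\<^sup>2) \<partial>M) \<le> of_nat (4 * CARD('m)) * ?h"
    by (rule LIMSEQ_le_const) (use J_le in blast)
  also have "\<dots> < \<infinity>" using h_fin by (simp add: ennreal_mult_less_top ennreal_of_nat_eq_real_of_nat)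
  finally show sq: "square_integrable M ?J" by (subst square_integrable_nn_integral) measurable
  fix G :: "'w \<Rightarrow> real^'d" assume G: "G \<in> borel_measurable (F s)" "square_integrable M G"
  let ?b = "\<bar>expectation (\<lambda>\<omega>. G \<omega> \<bullet> ?J \<omega>)\<bar>" and ?c = "sqrt (expectation (\<lambda>\<omega>. (norm (G \<omega>))\<^sup>2))"
  \<comment> \<open>\<open>G\<close> is orthogonal to \<open>J n\<close>, so only the error
    \<open>?J - J n\<close> contributes, and its second moment \<open>d n\<close> tends to
    0.\<close>
  have b: "?b \<le> ?c * sqrt (enn2real (d n))" for n
  proof -
    have sqd: "square_integrable M (\<lambda>\<omega>. ?J \<omega> - J n \<omega>)"
      by (rule square_integrable_diff[OF sq inc(1)])
    have "expectation (\<lambda>\<omega>. G \<omega> \<bullet> ?J \<omega>) = expectation (\<lambda>\<omega>. G \<omega> \<bullet> (?J \<omega> - J n \<omega>))"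
      using inc(3)[OF G] square_integrable_inner[OF G(2) sq] square_integrable_inner[OF G(2) inc(1)]
      by (simp only: inner_diff_right[of "G _" "I t _ - I s _"] Bochner_Integration.integral_diff)
    also have "\<bar>\<dots>\<bar> \<le> ?c * sqrt (expectation (\<lambda>\<omega>. (norm (?J \<omega> - J n \<omega>))\<^sup>2))"
      by (rule square_integrable_Cauchy_Schwarz[OF G(2) sqd])
    also have "expectation (\<lambda>\<omega>. (norm (?J \<omega> - J n \<omega>))\<^sup>2) = enn2real (d n)"
      unfolding d_def by (intro integral_eq_nn_integral) auto
    finally show ?thesis .
  qed
  have "(\<lambda>n. enn2real (d n)) \<longlonglongrightarrow> 0" using tendsto_enn2real[of d 0 sequentially] d by simp
  from tendsto_mult_right[OF tendsto_real_sqrt[OF this], of ?c]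
  have "(\<lambda>n. ?c * sqrt (enn2real (d n))) \<longlonglongrightarrow> 0" by (simp add: mult.commute)
  then have "?b \<le> 0" by (rule LIMSEQ_le_const) (use b in blast)
  then show "expectation (\<lambda>\<omega>. G \<omega> \<bullet> ?J \<omega>) = 0" by simp
qed

end

section \<open>Measurable suprema along paths, and the modulus of continuity\<close>

text \<open>A countable dense set gives the same supremum. Openness of \<open>A\<close> ensures that
  the dense set remains dense inside \<open>A\<close>.\<close>

lemma borel_measurable_cSUP_continuous:
  fixes Y :: "'i::second_countable_topology \<Rightarrow> 'w \<Rightarrow> real"
  assumes A: "open A" "A \<noteq> {}"
    and meas: "\<And>i. i \<in> A \<Longrightarrow> Y i \<in> borel_measurable N"
    and cont: "\<And>\<omega>. \<omega> \<in> space N \<Longrightarrow> continuous_on A (\<lambda>i. Y i \<omega>)"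
    and bdd: "\<And>\<omega>. \<omega> \<in> space N \<Longrightarrow> bdd_above ((\<lambda>i. Y i \<omega>) ` A)"
  shows "(\<lambda>\<omega>. SUP i\<in>A. Y i \<omega>) \<in> borel_measurable N"
proof -
  obtain D :: "'i set" where D: "countable D" "\<And>U. open U \<Longrightarrow> U \<noteq> {} \<Longrightarrow> \<exists>d\<in>D. d \<in> U"
    using countable_dense_exists by blast
  have ne: "A \<inter> D \<noteq> {}" using D(2)[OF A] by blast
  have bdd': "bdd_above ((\<lambda>i. Y i \<omega>) ` (A \<inter> D))" if "\<omega> \<in> space N" for \<omega>
    using bdd[OF that] by (rule bdd_above_mono) auto
  have "(SUP i\<in>A. Y i \<omega>) = (SUP i\<in>A \<inter> D. Y i \<omega>)" if \<omega>: "\<omega> \<in> space N" for \<omega>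
  proof (rule antisym)
    show "(SUP i\<in>A. Y i \<omega>) \<le> (SUP i\<in>A \<inter> D. Y i \<omega>)"
    proof (rule cSUP_least[OF A(2)], rule ccontr)
      fix i assume i: "i \<in> A" and "\<not> Y i \<omega> \<le> (SUP i\<in>A \<inter> D. Y i \<omega>)"
      \<comment> \<open>The indices whose value exceeds the countable supremum form an open set; if
        it is not empty it contains a point of \<open>D\<close>, a contradiction.\<close>
      moreover have "open (A \<inter> (\<lambda>i. Y i \<omega>) -` {(SUP i\<in>A \<inter> D. Y i \<omega>)<..})"
        using cont[OF \<omega>] A(1) by (metis Int_commute continuous_on_open_vimage open_greaterThan)
      ultimately obtain d where d: "d \<in> D" "d \<in> A" "(SUP i\<in>A \<inter> D. Y i \<omega>) < Y d \<omega>"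
        using D(2) by (metis (no_types, lifting) IntD1 IntD2 IntI empty_iff greaterThan_iff not_le vimage_eq)
      then show False using cSUP_upper[OF _ bdd'[OF \<omega>], of d] by fastforce
    qed
    show "(SUP i\<in>A \<inter> D. Y i \<omega>) \<le> (SUP i\<in>A. Y i \<omega>)"
      using ne bdd[OF \<omega>] by (intro cSUP_subset_mono) auto
  qed
  moreover have "(\<lambda>\<omega>. SUP i\<in>A \<inter> D. Y i \<omega>) \<in> borel_measurable N"
    using D(1) meas bdd' by (intro borel_measurable_cSUP) auto
  ultimately show ?thesis by (simp cong: measurable_cong)
qed

lemma norm_set_integral_le:
  fixes u :: "real \<Rightarrow> 'a::euclidean_space"
  assumes "s \<le> t" "set_integrable lborel {s<..t} u" "\<And>r. r \<in> {s<..t} \<Longrightarrow> norm (u r) \<le> c"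
  shows "norm (LINT r:{s<..t}|lborel. u r) \<le> (t - s) * c"
proof -
  have "norm (LINT r:{s<..t}|lborel. u r) \<le> (LINT r|lborel. norm (indicator {s<..t} r *\<^sub>R u r))"
    unfolding set_lebesgue_integral_def by (rule integral_norm_bound)
  also have "\<dots> \<le> (LINT r|lborel. indicator {s<..t} r *\<^sub>R c)"
  proof (rule integral_mono)
    show "integrable lborel (\<lambda>r. norm (indicator {s<..t} r *\<^sub>R u r))"
      using assms(2) unfolding set_integrable_def by (rule integrable_norm)
    show "integrable lborel (\<lambda>r. indicator {s<..t} r *\<^sub>R c)"
      using assms(1) by (intro integrable_scaleR_left) (simp add: integrable_indicator_iff)
  qed (use assms(3) in \<open>auto simp: indicator_def\<close>)
  also have "\<dots> = (t - s) * c" using assms(1) by simp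
  finally show ?thesis .
qed

context brownian_motion begin

text \<open>\<open>Q\<close> is the running maximum of the path and \<open>osc n\<close> its modulus
  of continuity at mesh \<open>T / Suc n\<close>. A path is uniformly continuous on the compact
  interval, so \<open>osc n\<close> tends to 0 pointwise; the bound by \<open>2 * Q\<close> prepares
  dominated convergence.\<close>

lemma S2_upto_oscillation:
  fixes X :: "real \<Rightarrow> 'w \<Rightarrow> real^'d"
  assumes X: "X \<in> S2_upto M F T" and T: "0 \<le> T"
  obtains Q osc where "square_integrable M Q" "\<And>n. osc n \<in> borel_measurable M"
    and "\<And>r \<omega>. r \<in> {0..T} \<Longrightarrow> \<omega> \<in> space M \<Longrightarrow> norm (X r \<omega>) \<le> Q \<omega>"
    and "\<And>n r s \<omega>. r \<in> {0..T} \<Longrightarrow> s \<in> {0..T} \<Longrightarrow> \<bar>r - s\<bar> \<le> T / Suc n \<Longrightarrow> \<omega> \<in> space M \<Longrightarrow>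
      norm (X r \<omega> - X s \<omega>) \<le> osc n \<omega>"
    and "\<And>n \<omega>. \<omega> \<in> space M \<Longrightarrow> osc n \<omega> \<le> 2 * Q \<omega>"
    and "\<And>\<omega>. \<omega> \<in> space M \<Longrightarrow> (\<lambda>n. osc n \<omega>) \<longlonglongrightarrow> (0::real)"
proof -
  \<comment> \<open>Clipping time replaces the closed interval by the whole line, an open index set
    as the measurability of suprema demands.\<close>
  define c where "c r = max 0 (min T r)" for r
  \<comment> \<open>With \<open>T + 1\<close> in place of \<open>T\<close> the strict inequality in
    \<open>A n\<close> covers the closed mesh condition, and \<open>A n\<close> is not empty even
    for \<open>T = 0\<close>.\<close>
  define \<delta> where "\<delta> n = (T + 1) / Suc n" for n
  define A where "A n = {p :: real \<times> real. \<bar>fst p - snd p\<bar> < \<delta> n}" for n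
  define Q where "Q \<omega> = (SUP r. norm (X (c r) \<omega>))" for \<omega>
  define osc where "osc n \<omega> = (SUP p\<in>A n. norm (X (c (fst p)) \<omega> - X (c (snd p)) \<omega>))" for n \<omega>
  have c: "c r \<in> {0..T}" "\<bar>c r - c s\<bar> \<le> \<bar>r - s\<bar>" for r s
    using T by (auto simp: c_def)
  have c_id: "r \<in> {0..T} \<Longrightarrow> c r = r" for r by (auto simp: c_def)
  have ccont: "continuous_on UNIV c" unfolding c_def[abs_def] by (intro continuous_intros)
  have cont: "continuous_on {0..T} (\<lambda>r. X r \<omega>)" if "\<omega> \<in> space M" for \<omega>
    using X that by (auto simp: S2_upto_def S0_upto_def)
  have prog: "prog_measurable_upto F T X" and fin: "(\<integral>\<^sup>+\<omega>. (SUP t\<in>{0..T}. ennreal ((norm (X t \<omega>))\<^sup>2)) \<partial>M) < \<infinity>"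
    using X by (auto simp: S2_upto_def S0_upto_def)
  have Xc: "continuous_on UNIV (\<lambda>r. X (c r) \<omega>)" if "\<omega> \<in> space M" for \<omega>
    using continuous_on_compose2[OF cont[OF that] ccont] c by blast
  have meas[measurable]: "X (c r) \<in> borel_measurable M" for r
    using measurable_compose[OF measurable_Pair1'[of r borel M] prog_measurable_upto_clip[OF prog T]]
    by (simp add: c_def)
  \<comment> \<open>The maximum is attained, so \<open>(Q \<omega>)\<^sup>2\<close> is one of the
    values under the extended supremum in the definition of \<open>S2_upto\<close>.\<close>
  have att: "\<exists>r0\<in>{0..T}. \<forall>r. norm (X (c r) \<omega>) \<le> norm (X r0 \<omega>)" if "\<omega> \<in> space M" for \<omega>
  proof -
    note cont\<omega> = continuous_on_norm[OF cont[OF that]]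
    obtain r0 where "r0 \<in> {0..T}" "\<And>r. r \<in> {0..T} \<Longrightarrow> norm (X r \<omega>) \<le> norm (X r0 \<omega>)"
      using continuous_attains_sup[of "{0..T}" "\<lambda>r. norm (X r \<omega>)"] T cont\<omega>
      by auto
    then show ?thesis using c by blast
  qed
  have bddQ: "bdd_above (range (\<lambda>r. norm (X (c r) \<omega>)))" if "\<omega> \<in> space M" for \<omega>
    using att[OF that] by (auto simp: bdd_above_def)
  have Q_meas: "Q \<in> borel_measurable M"
    unfolding Q_def[abs_def] using Xc bddQ
    by (intro borel_measurable_cSUP_continuous) (auto intro!: continuous_on_norm)
  have Xc_le: "norm (X (c r) \<omega>) \<le> Q \<omega>" if "\<omega> \<in> space M" for r \<omega>
    unfolding Q_def using bddQ[OF that] by (intro cSUP_upper) auto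
  have X_le: "norm (X r \<omega>) \<le> Q \<omega>" if "r \<in> {0..T}" "\<omega> \<in> space M" for r \<omega>
    using Xc_le[OF that(2), of r] c_id[OF that(1)] by simp
  have "(\<integral>\<^sup>+\<omega>. ennreal ((norm (Q \<omega>))\<^sup>2) \<partial>M) \<le> (\<integral>\<^sup>+\<omega>. (SUP t\<in>{0..T}. ennreal ((norm (X t \<omega>))\<^sup>2)) \<partial>M)"
  proof (rule nn_integral_mono)
    fix \<omega> assume \<omega>: "\<omega> \<in> space M"
    obtain r0 where r0: "r0 \<in> {0..T}" "\<And>r. norm (X (c r) \<omega>) \<le> norm (X r0 \<omega>)" using att[OF \<omega>] by blast
    have "Q \<omega> \<le> norm (X r0 \<omega>)" unfolding Q_def by (rule cSUP_least) (use r0 in auto)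
    moreover have "0 \<le> Q \<omega>" using order_trans[OF norm_ge_zero Xc_le[OF \<omega>]] .
    ultimately have "(norm (Q \<omega>))\<^sup>2 \<le> (norm (X r0 \<omega>))\<^sup>2" by (intro power_mono) auto
    then show "ennreal ((norm (Q \<omega>))\<^sup>2) \<le> (SUP t\<in>{0..T}. ennreal ((norm (X t \<omega>))\<^sup>2))"
      using r0(1) by (intro SUP_upper2[of r0]) (auto intro: ennreal_leI)
  qed
  then have Q_sq: "square_integrable M Q"
    using fin by (subst square_integrable_nn_integral[OF Q_meas]) (rule order_le_less_trans)
  have \<delta>: "0 < \<delta> n" "T / Suc n < \<delta> n" for n using T by (auto simp: \<delta>_def divide_strict_right_mono)
  have \<delta>0: "\<delta> \<longlonglongrightarrow> 0"
    unfolding \<delta>_def[abs_def] by (rule LIMSEQ_Suc[OF lim_const_over_n])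
  have A: "open (A n)" "A n \<noteq> {}" for n
  proof -
    show "open (A n)" unfolding A_def by (intro open_Collect_less continuous_intros)
    have "(0, 0) \<in> A n" using \<delta> by (simp add: A_def)
    then show "A n \<noteq> {}" by blast
  qed
  have diff_le: "norm (X (c r) \<omega> - X (c s) \<omega>) \<le> 2 * Q \<omega>" if "\<omega> \<in> space M" for r s \<omega>
    using norm_triangle_ineq4[of "X (c r) \<omega>" "X (c s) \<omega>"] Xc_le[OF that, of r] Xc_le[OF that, of s] by linarith
  have bddosc: "bdd_above ((\<lambda>p. norm (X (c (fst p)) \<omega> - X (c (snd p)) \<omega>)) ` A n)" if "\<omega> \<in> space M" for n \<omega>
    using diff_le[OF that] by (auto intro!: bdd_aboveI)
  have "osc n \<in> borel_measurable M" for n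
    unfolding osc_def[abs_def] using A bddosc
    by (intro borel_measurable_cSUP_continuous)
      (auto intro!: continuous_on_norm continuous_on_diff continuous_on_compose2[OF Xc] continuous_intros)
  moreover have "norm (X r \<omega> - X s \<omega>) \<le> osc n \<omega>"
    if rs: "r \<in> {0..T}" "s \<in> {0..T}" "\<bar>r - s\<bar> \<le> T / Suc n" and \<omega>: "\<omega> \<in> space M" for n r s \<omega>
  proof -
    have "(r, s) \<in> A n" using rs(3) \<delta>(2)[of n] by (simp add: A_def)
    from cSUP_upper[OF this bddosc[OF \<omega>]] show ?thesis
      using c_id rs by (simp add: osc_def)
  qed
  moreover have "osc n \<omega> \<le> 2 * Q \<omega>" if "\<omega> \<in> space M" for n \<omega>
    unfolding osc_def using diff_le[OF that] by (intro cSUP_least A)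
  moreover have "(\<lambda>n. osc n \<omega>) \<longlonglongrightarrow> 0" if \<omega>: "\<omega> \<in> space M" for \<omega>
  proof (rule LIMSEQ_I)
    fix e :: real assume e: "0 < e"
    \<comment> \<open>The half leaves room, since a supremum of values strictly below a bound may
      equal that bound.\<close>
    obtain d where d: "d > 0" "\<And>r s. r \<in> {0..T} \<Longrightarrow> s \<in> {0..T} \<Longrightarrow> dist s r < d \<Longrightarrow> dist (X s \<omega>) (X r \<omega>) < e / 2"
      using compact_uniformly_continuous[OF cont[OF \<omega>]] e unfolding uniformly_continuous_on_def
      by (metis compact_Icc half_gt_zero)
    obtain n0 where n0: "\<And>n. n \<ge> n0 \<Longrightarrow> \<delta> n < d"
      using order_tendstoD(2)[OF \<delta>0 d(1)] by (auto simp: eventually_sequentially)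
    have "norm (osc n \<omega> - 0) < e" if "n \<ge> n0" for n
    proof -
      have "osc n \<omega> \<le> e / 2" unfolding osc_def
      proof (rule cSUP_least[OF A(2)])
        fix p assume "p \<in> A n"
        then have "dist (c (fst p)) (c (snd p)) < d"
          using c(2)[of "fst p" "snd p"] n0[OF that] by (simp add: A_def dist_real_def)
        then show "norm (X (c (fst p)) \<omega> - X (c (snd p)) \<omega>) \<le> e / 2"
          using d(2)[OF c(1) c(1)] by (fastforce simp: dist_norm)
      qed
      moreover have "0 \<le> osc n \<omega>"
      proof -
        obtain p where "p \<in> A n" using A(2) by blast
        from cSUP_upper[OF this bddosc[OF \<omega>]] show ?thesis
          unfolding osc_def by (rule order_trans[OF norm_ge_zero])
      qed
      ultimately show ?thesis using e by simp
    qed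
    then show "\<exists>n0. \<forall>n\<ge>n0. norm (osc n \<omega> - 0) < e" by blast
  qed
  ultimately show ?thesis using that[of Q osc] Q_sq X_le by blast
qed

end

section \<open>Convex analysis, and the deterministic one-step inequality\<close>

lemma line_has_real_derivative:
  fixes f :: "'a::real_inner \<Rightarrow> real"
  assumes "\<And>x. GDERIV f x :> g x"
  shows "((\<lambda>u. f (x + u *\<^sub>R v)) has_real_derivative g (x + u *\<^sub>R v) \<bullet> v) (at u)"
proof -
  have "((\<lambda>u. x + u *\<^sub>R v) has_derivative (\<lambda>h. h *\<^sub>R v)) (at u)"
    by (auto intro!: derivative_eq_intros)
  from has_derivative_compose[OF this, of f "\<lambda>h. h \<bullet> g (x + u *\<^sub>R v)"]
  show ?thesis using assms[of "x + u *\<^sub>R v"]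
    by (simp add: gderiv_def has_field_derivative_def inner_commute mult_commute_abs)
qed

text \<open>Along the segment from \<open>x\<close> to \<open>y\<close> the function is convex in
  one variable and lies above its tangent at 0.\<close>

lemma convex_gradient_inequality:
  fixes f :: "'a::real_inner \<Rightarrow> real"
  assumes "convex_on UNIV f" "\<And>x. GDERIV f x :> g x"
  shows "f x - f y \<le> g x \<bullet> (x - y)"
proof -
  let ?\<phi> = "\<lambda>u. f (x + u *\<^sub>R (y - x))"
  have "convex_on UNIV ?\<phi>"
  proof (rule convex_onI)
    fix t a b :: real assume t: "0 < t" "t < 1"
    have "x + ((1 - t) *\<^sub>R a + t *\<^sub>R b) *\<^sub>R (y - x)
      = (1 - t) *\<^sub>R (x + a *\<^sub>R (y - x)) + t *\<^sub>R (x + b *\<^sub>R (y - x))"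
      by (simp add: algebra_simps)
    then show "?\<phi> ((1 - t) *\<^sub>R a + t *\<^sub>R b) \<le> (1 - t) * ?\<phi> a + t * ?\<phi> b"
      using convex_onD[OF assms(1), of t] t by simp
  qed simp
  from convex_on_imp_above_tangent[OF this, of 0 1 "g x \<bullet> (y - x)"]
  have "g x \<bullet> (y - x) \<le> f y - f x"
    using line_has_real_derivative[OF assms(2), of x "y - x" 0] by simp
  then show ?thesis by (simp add: inner_diff_right)
qed

text \<open>The mean value theorem gives the gradient at an intermediate point, at most
  \<open>norm (y - x)\<close> away from \<open>x\<close>. Hence the constant \<open>L\<close>, where
  integrating along the segment would give \<open>L / 2\<close>.\<close>

lemma lipschitz_gradient_descent:
  fixes f :: "'a::real_inner \<Rightarrow> real"
  assumes "L-lipschitz_on UNIV g" "\<And>x. GDERIV f x :> g x"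
  shows "f y - f x \<le> g x \<bullet> (y - x) + L * (norm (y - x))\<^sup>2"
proof -
  obtain u where u: "0 < u" "u < 1" "f y - f x = g (x + u *\<^sub>R (y - x)) \<bullet> (y - x)"
    using MVT2[of 0 1 "\<lambda>u. f (x + u *\<^sub>R (y - x))" "\<lambda>u. g (x + u *\<^sub>R (y - x)) \<bullet> (y - x)"]
      line_has_real_derivative[OF assms(2)] by auto
  have L: "0 \<le> L" using assms(1) by (rule lipschitz_on_nonneg)
  have "norm (g (x + u *\<^sub>R (y - x)) - g x) \<le> L * norm (u *\<^sub>R (y - x))"
    using lipschitz_onD[OF assms(1), of "x + u *\<^sub>R (y - x)" x] by (simp add: dist_norm)
  also have "\<dots> \<le> L * norm (y - x)"
    using u L by (intro mult_left_mono) (auto simp: mult_left_le_one_le)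
  finally have "norm (g (x + u *\<^sub>R (y - x)) - g x) * norm (y - x) \<le> L * norm (y - x) * norm (y - x)"
    by (rule mult_right_mono) simp
  moreover have "(g (x + u *\<^sub>R (y - x)) - g x) \<bullet> (y - x) \<le> norm (g (x + u *\<^sub>R (y - x)) - g x) * norm (y - x)"
    by (rule norm_cauchy_schwarz)
  ultimately show ?thesis using u(3) by (simp add: inner_diff_left power2_eq_square)
qed

text \<open>The derivative in the direction of the gradient itself vanishes at a minimum.\<close>

lemma gradient_minimum_eq_0:
  fixes f :: "'a::real_inner \<Rightarrow> real"
  assumes "\<And>x. f z \<le> f x" "\<And>x. GDERIV f x :> g x"
  shows "g z = 0"
proof -
  have "((\<lambda>u. f (z + u *\<^sub>R g z)) has_real_derivative g z \<bullet> g z) (at 0)"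
    using line_has_real_derivative[OF assms(2), of z "g z" 0] by simp
  then have "g z \<bullet> g z = 0"
    by (rule DERIV_local_min[where d=1]) (use assms(1) in auto)
  then show ?thesis by simp
qed

text \<open>
  One step of the partition: \<open>D\<close> is the integrated gradient, \<open>J\<close> the increment of the stochastic
  integral, \<open>w\<close> bounds the oscillation of the path on \<open>[s, t]\<close> and \<open>B\<close> its distance to \<open>z\<close>.  The
  square of the increment is expanded so that the cross term is \<open>D \<bullet> (x' - x)\<close>, which is of size
  \<open>\<delta> w B\<close>.
\<close>
lemma lyapunov_step:
  fixes x x' z D J g :: "'a::real_inner"
  assumes dx: "x' - x = J - D" and time: "t = s + \<delta>" "0 \<le> \<delta>" "0 \<le> s" "t \<le> T"
    and descent: "\<Phi>' - \<Phi> \<le> g \<bullet> (x' - x) + L * (norm (x' - x))\<^sup>2"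
    and convex: "\<Phi> \<le> g \<bullet> (x - z)"
    and bounds: "norm (D - \<delta> *\<^sub>R g) \<le> \<delta> * (L * w)" "norm (x' - x) \<le> w" "norm D \<le> \<delta> * (L * B)"
      "norm g \<le> L * B" "norm (x - z) \<le> B" and L: "0 \<le> L"
  shows "t * \<Phi>' + (norm (x' - z))\<^sup>2 / 2 \<le> s * \<Phi> + (norm (x - z))\<^sup>2 / 2
    + (t *\<^sub>R g + (x - z)) \<bullet> J + (t * L + 1 / 2) * (norm J)\<^sup>2 + \<delta> * ((3 * T * L\<^sup>2 + 2 * L) * (w * B))"
proof -
  let ?\<Delta> = "x' - x"
  have wB: "0 \<le> w" "0 \<le> B" using order_trans[OF norm_ge_zero] bounds by blast+
  have t: "0 \<le> t" using time by simp
  have p: "0 \<le> \<delta> * w * B" using wB time by simp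
  \<comment> \<open>The part \<open>\<delta> * (g \<bullet> g)\<close> has the favourable sign and
    is dropped; the deviation of \<open>D\<close> from \<open>\<delta> *\<^sub>R g\<close> is small
    with the oscillation.\<close>
  have "g \<bullet> D = \<delta> * (g \<bullet> g) + g \<bullet> (D - \<delta> *\<^sub>R g)" by (simp add: inner_diff_right)
  moreover have "\<bar>g \<bullet> (D - \<delta> *\<^sub>R g)\<bar> \<le> (L * B) * (\<delta> * (L * w))"
    using Cauchy_Schwarz_ineq2 mult_mono[OF bounds(4,1)] L wB by (meson mult_nonneg_nonneg norm_ge_zero order_trans)
  moreover have "0 \<le> \<delta> * (g \<bullet> g)" using time by simp
  ultimately have gD: "- (g \<bullet> D) \<le> L\<^sup>2 * (\<delta> * w * B)" by (simp add: power2_eq_square algebra_simps)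
  have "- ((x - z) \<bullet> (D - \<delta> *\<^sub>R g)) \<le> B * (\<delta> * (L * w))"
    using Cauchy_Schwarz_ineq2[of "x - z" "D - \<delta> *\<^sub>R g"] mult_mono[OF bounds(5,1) wB(2) norm_ge_zero] by linarith
  then have xD: "- ((x - z) \<bullet> (D - \<delta> *\<^sub>R g)) \<le> L * (\<delta> * w * B)" by (simp add: algebra_simps)
  have "J = ?\<Delta> + D" using dx by simp
  then have "(norm ?\<Delta>)\<^sup>2 = (norm J)\<^sup>2 - 2 * (D \<bullet> ?\<Delta>) - (norm D)\<^sup>2"
    by (simp add: power2_norm_eq_inner inner_add inner_commute)
  moreover have "- (D \<bullet> ?\<Delta>) \<le> (\<delta> * (L * B)) * w"
    using Cauchy_Schwarz_ineq2[of D ?\<Delta>] mult_mono[OF bounds(3,2) order_trans[OF norm_ge_zero bounds(3)] norm_ge_zero] by linarith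
  moreover have "0 \<le> (norm D)\<^sup>2" by simp
  ultimately have "(norm ?\<Delta>)\<^sup>2 \<le> (norm J)\<^sup>2 + 2 * ((\<delta> * (L * B)) * w)" by linarith
  also have "\<dots> = (norm J)\<^sup>2 + 2 * L * (\<delta> * w * B)" by (simp only: mult_ac)
  finally have \<Delta>2: "(norm ?\<Delta>)\<^sup>2 \<le> (norm J)\<^sup>2 + 2 * L * (\<delta> * w * B)" .
  have "(norm (x' - z))\<^sup>2 = (norm ((x - z) + ?\<Delta>))\<^sup>2" by simp
  also have "\<dots> = (norm (x - z))\<^sup>2 + 2 * ((x - z) \<bullet> ?\<Delta>) + (norm ?\<Delta>)\<^sup>2"
  proof -
    have "(norm (p + q))\<^sup>2 = (norm p)\<^sup>2 + 2 * (p \<bullet> q) + (norm q)\<^sup>2" for p q :: 'a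
      by (simp add: power2_norm_eq_inner inner_add inner_commute)
    then show ?thesis .
  qed
  finally have sq: "(norm (x' - z))\<^sup>2 / 2 = (norm (x - z))\<^sup>2 / 2 + (x - z) \<bullet> ?\<Delta> + (norm ?\<Delta>)\<^sup>2 / 2"
    by simp
  have "t * \<Phi>' \<le> t * (\<Phi> + g \<bullet> ?\<Delta> + L * (norm ?\<Delta>)\<^sup>2)"
    using descent t by (intro mult_left_mono) auto
  \<comment> \<open>The weight rises from \<open>s\<close> to \<open>t\<close>, and the extra
    \<open>\<delta> * \<Phi>\<close> is paid for by convexity.\<close>
  moreover have "\<delta> * \<Phi> \<le> \<delta> * (g \<bullet> (x - z))" using convex time by (intro mult_left_mono)
  ultimately have "t * \<Phi>' + (norm (x' - z))\<^sup>2 / 2 \<le> s * \<Phi> + (norm (x - z))\<^sup>2 / 2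
      + (t * (g \<bullet> ?\<Delta>) + \<delta> * (g \<bullet> (x - z)) + (x - z) \<bullet> ?\<Delta>) + (t * L + 1 / 2) * (norm ?\<Delta>)\<^sup>2"
    unfolding sq time(1) by (simp add: algebra_simps)
  \<comment> \<open>The convexity term \<open>\<delta> * (g \<bullet> (x - z))\<close> cancels the
    leading drift of the squared distance, leaving the noise term and two small remainders.\<close>
  also have "t * (g \<bullet> ?\<Delta>) + \<delta> * (g \<bullet> (x - z)) + (x - z) \<bullet> ?\<Delta>
      = (t *\<^sub>R g + (x - z)) \<bullet> J + t * (- (g \<bullet> D)) + - ((x - z) \<bullet> (D - \<delta> *\<^sub>R g))"
    unfolding dx by (simp add: inner_add_left inner_diff_left inner_diff_right inner_commute[of _ g] algebra_simps)
  also have "s * \<Phi> + (norm (x - z))\<^sup>2 / 2 + ((t *\<^sub>R g + (x - z)) \<bullet> J + t * (- (g \<bullet> D)) + - ((x - z) \<bullet> (D - \<delta> *\<^sub>R g)))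
      + (t * L + 1 / 2) * (norm ?\<Delta>)\<^sup>2
    \<le> s * \<Phi> + (norm (x - z))\<^sup>2 / 2 + ((t *\<^sub>R g + (x - z)) \<bullet> J + t * (L\<^sup>2 * (\<delta> * w * B)) + L * (\<delta> * w * B))
      + (t * L + 1 / 2) * ((norm J)\<^sup>2 + 2 * L * (\<delta> * w * B))"
    using gD xD \<Delta>2 t L by (intro add_mono mult_left_mono order_refl) auto
  \<comment> \<open>The constant is \<open>t * L\<^sup>2 + L\<close> from the two remainders plus
    \<open>(t * L + 1 / 2) * (2 * L)\<close> from the squared increment.\<close>
  also have "\<dots> = s * \<Phi> + (norm (x - z))\<^sup>2 / 2 + (t *\<^sub>R g + (x - z)) \<bullet> J + (t * L + 1 / 2) * (norm J)\<^sup>2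
      + (3 * t * L\<^sup>2 + 2 * L) * (\<delta> * w * B)"
    by (simp add: algebra_simps power2_eq_square)
  also have "\<dots> \<le> s * \<Phi> + (norm (x - z))\<^sup>2 / 2 + (t *\<^sub>R g + (x - z)) \<bullet> J + (t * L + 1 / 2) * (norm J)\<^sup>2
      + (3 * T * L\<^sup>2 + 2 * L) * (\<delta> * w * B)"
    using time(4) p by (intro add_left_mono mult_right_mono add_right_mono) auto
  finally show ?thesis by (simp only: mult_ac)
qed

section \<open>The stochastic gradient flow: integrability and the noise budget\<close>

locale gradient_sde = brownian_motion M F W
  for M :: "'w measure" and F :: "real \<Rightarrow> 'w measure" and W :: "real \<Rightarrow> 'w \<Rightarrow> real ^ 'm" +
  fixes f :: "real ^ 'd \<Rightarrow> real" and gradf :: "real ^ 'd \<Rightarrow> real ^ 'd" and z :: "real ^ 'd"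
    and \<sigma> :: "real \<Rightarrow> real ^ 'd \<Rightarrow> real ^ 'm ^ 'd"
    and X :: "real \<Rightarrow> 'w \<Rightarrow> real ^ 'd" and X0 :: "real ^ 'd"
    and L C :: real
  assumes f_convex: "convex_on UNIV f"
    and f_deriv: "\<And>x. GDERIV f x :> gradf x"
    and f_lipschitz: "L-lipschitz_on UNIV gradf"
    and f_min: "\<And>x. f z \<le> f x"
    and \<sigma>_meas: "(\<lambda>(t, x). \<sigma> t x) \<in> borel_measurable (restrict_space borel {0..} \<Otimes>\<^sub>M borel)"
    and \<sigma>_le: "\<And>t x. 0 \<le> t \<Longrightarrow> norm (\<sigma> t x) \<le> C"
    and \<sigma>_cont: "\<And>t. 0 \<le> t \<Longrightarrow> continuous_on UNIV (\<sigma> t)"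
    and X_S2: "X \<in> S2 M F"
    and X_sol: "sde_solution M F W (\<lambda>x. - gradf x) \<sigma> X0 X"
begin

lemma L_nonneg: "0 \<le> L"
  using f_lipschitz by (rule lipschitz_on_nonneg)

lemma gradf_continuous: "continuous_on A gradf"
  using lipschitz_on_continuous_on[OF f_lipschitz] by (rule continuous_on_subset) simp

lemma gradf_diff_le: "norm (gradf x - gradf y) \<le> L * norm (x - y)"
  using lipschitz_onD[OF f_lipschitz] by (simp add: dist_norm)

lemma gradf_le: "norm (gradf x) \<le> L * norm (x - z)"
  using gradf_diff_le[of x z] gradient_minimum_eq_0[of f z gradf] f_min f_deriv by simp

text \<open>Descent from the minimiser, where the gradient vanishes. Quadratic growth makes the gap
  integrable along a square integrable solution.\<close>

lemma gap_le: "f x - f z \<le> L * (norm (x - z))\<^sup>2"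
  using lipschitz_gradient_descent[OF f_lipschitz f_deriv, of x z]
    gradient_minimum_eq_0[of f z gradf] f_min f_deriv by simp

lemma f_continuous: "continuous_on UNIV f"
  using f_deriv unfolding gderiv_def
  by (intro continuous_at_imp_continuous_on ballI) (rule has_derivative_continuous)

lemma sigma_inf_bounds:
  assumes "0 \<le> t"
  shows "norm (\<sigma> t x) \<le> sigma_inf \<sigma> t" "0 \<le> sigma_inf \<sigma> t" "sigma_inf \<sigma> t \<le> C"
proof -
  have bdd: "bdd_above (range (\<lambda>x. norm (\<sigma> t x)))"
    using \<sigma>_le[OF assms] by (auto simp: bdd_above_def)
  show 1: "norm (\<sigma> t x) \<le> sigma_inf \<sigma> t" for x
    unfolding sigma_inf_def frobenius_norm_eq_norm by (rule cSUP_upper[OF _ bdd]) simp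
  show "0 \<le> sigma_inf \<sigma> t" using order_trans[OF norm_ge_zero 1] .
  show "sigma_inf \<sigma> t \<le> C"
    unfolding sigma_inf_def frobenius_norm_eq_norm using \<sigma>_le[OF assms] by (intro cSUP_least) auto
qed

text \<open>The clipping makes \<^term>\<open>sigma_inf \<sigma>\<close>, constrained at \<open>t \<ge> 0\<close> only, measurable on all of the line.\<close>
definition h :: "real \<Rightarrow> real" where "h r = sigma_inf \<sigma> (max 0 r)"

text \<open>For each position the norm is measurable in time; continuity in space reduces the
  supremum over positions to a countable one.\<close>

lemma h_meas [measurable]: "h \<in> borel_measurable borel"
  unfolding h_def[abs_def] sigma_inf_def frobenius_norm_eq_norm
proof (rule borel_measurable_cSUP_continuous)
  fix x :: "real^'d"
  have m: "(\<lambda>r. (max 0 r, x)) \<in> (borel :: real measure) \<rightarrow>\<^sub>M restrict_space borel {0..} \<Otimes>\<^sub>M borel"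
    by (intro measurable_Pair measurable_restrict_space2) auto
  have "(\<lambda>r. \<sigma> (max 0 r) x) \<in> borel_measurable borel"
    using measurable_compose[OF m \<sigma>_meas] by simp
  then show "(\<lambda>r. norm (\<sigma> (max 0 r) x)) \<in> borel_measurable borel" by measurable
next
  fix r :: real
  show "continuous_on UNIV (\<lambda>x. norm (\<sigma> (max 0 r) x))"
    by (intro continuous_on_norm \<sigma>_cont) simp
  show "bdd_above (range (\<lambda>x. norm (\<sigma> (max 0 r) x)))"
    using \<sigma>_le[of "max 0 r"] by (auto simp: bdd_above_def)
qed auto

lemma h_bounds: "0 \<le> h r" "h r \<le> C" "0 \<le> r \<Longrightarrow> norm (\<sigma> r x) \<le> h r"
  using sigma_inf_bounds[of "max 0 r"] sigma_inf_bounds(1)[of r] by (auto simp: h_def max_def)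

text \<open>The left side of the growth hypothesis, kept unevaluated until the final
  estimate.\<close>

definition \<Psi> :: "real \<Rightarrow> real" where
  "\<Psi> t = (LINT r:{0..t}|lborel. (r + 1) * (sigma_inf \<sigma> r)\<^sup>2)"

lemma h_integrable:
  assumes "0 \<le> a"
  shows "set_integrable lborel {a<..b} (\<lambda>r. (r + 1) * (h r)\<^sup>2)" "set_integrable lborel {a..b} (\<lambda>r. (r + 1) * (h r)\<^sup>2)"
    "set_integrable lborel {a<..b} (\<lambda>r. (h r)\<^sup>2)"
proof -
  have sq: "(h r)\<^sup>2 \<le> C\<^sup>2" for r using h_bounds[of r] by (intro power_mono)
  have b: "norm ((r + 1) * (h r)\<^sup>2) \<le> (b + 1) * C\<^sup>2" if "0 \<le> r" "r \<le> b" for r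
    using that sq[of r] by (auto simp: abs_mult intro!: mult_mono)
  show 1: "set_integrable lborel {a..b} (\<lambda>r. (r + 1) * (h r)\<^sup>2)"
    unfolding set_integrable_def
    by (rule integrableI_bounded_set_indicator[where B="(b + 1) * C\<^sup>2"])
      (use b assms in \<open>auto simp: emeasure_lborel_Icc_eq less_top\<close>)
  have 2: "set_integrable lborel {a..b} (\<lambda>r. (h r)\<^sup>2)"
    unfolding set_integrable_def
    by (rule integrableI_bounded_set_indicator[where B="C\<^sup>2"])
      (use sq in \<open>auto simp: emeasure_lborel_Icc_eq less_top\<close>)
  show "set_integrable lborel {a<..b} (\<lambda>r. (r + 1) * (h r)\<^sup>2)" "set_integrable lborel {a<..b} (\<lambda>r. (h r)\<^sup>2)"
    by (rule set_integrable_subset[OF 1] set_integrable_subset[OF 2]; auto)+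
qed

lemma \<Psi>_diff:
  assumes "0 \<le> s" "s \<le> t"
  shows "\<Psi> t - \<Psi> s = (LINT r:{s<..t}|lborel. (r + 1) * (h r)\<^sup>2)"
proof -
  have \<Psi>: "\<Psi> u = (LINT r:{0..u}|lborel. (r + 1) * (h r)\<^sup>2)" for u
    unfolding \<Psi>_def by (intro set_lebesgue_integral_cong) (auto simp: h_def max_def)
  have "{0..t} = {0..s} \<union> {s<..t}" "{0..s} \<inter> {s<..t} = {}" using assms by auto
  then show ?thesis
    unfolding \<Psi> using set_integral_Un[OF _ h_integrable(2)[of 0 s] h_integrable(1)[of s t]] assms by auto
qed

text \<open>The one-step inequality weights the noise by the right endpoint. On an interval of
  length at most 1, \<open>t + 1 \<le> 2 * (r + 1)\<close> compares this with the weight inside the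
  integral.\<close>

lemma weighted_noise_le:
  assumes st: "0 \<le> s" "s \<le> t" "t \<le> s + 1"
  shows "(t + 1) * (LINT r:{s<..t}|lborel. (h r)\<^sup>2) \<le> 2 * (\<Psi> t - \<Psi> s)"
proof -
  have "(t + 1) * (LINT r:{s<..t}|lborel. (h r)\<^sup>2) = (LINT r:{s<..t}|lborel. (t + 1) * (h r)\<^sup>2)"
    by simp
  also have "\<dots> \<le> (LINT r:{s<..t}|lborel. 2 * ((r + 1) * (h r)\<^sup>2))"
  proof (rule set_integral_mono)
    show "set_integrable lborel {s<..t} (\<lambda>r. (t + 1) * (h r)\<^sup>2)"
      using h_integrable(3)[OF st(1)] by simp
    show "set_integrable lborel {s<..t} (\<lambda>r. 2 * ((r + 1) * (h r)\<^sup>2))"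
      using h_integrable(1)[OF st(1)] by (intro set_integrable_mult_right) simp
    show "(t + 1) * (h r)\<^sup>2 \<le> 2 * ((r + 1) * (h r)\<^sup>2)" if "r \<in> {s<..t}" for r
    proof -
      have "t + 1 \<le> 2 * (r + 1)" using that st by simp
      from mult_right_mono[OF this zero_le_power2] show ?thesis by (simp only: mult.assoc)
    qed
  qed
  also have "\<dots> = 2 * (\<Psi> t - \<Psi> s)" using \<Psi>_diff st by simp
  finally show ?thesis .
qed

lemma solution_regularity:
  assumes "0 \<le> t"
  shows "X t \<in> borel_measurable (F t)" "X t \<in> borel_measurable M" "square_integrable M (\<lambda>\<omega>. X t \<omega> - y)"
    and "\<omega> \<in> space M \<Longrightarrow> continuous_on {0..t} (\<lambda>r. X r \<omega>)"
proof -
  have X: "X \<in> S2_upto M F t" using X_S2 assms by (auto simp: S2_def)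
  then show Ft: "X t \<in> borel_measurable (F t)"
    using prog_measurable_upto_adapted assms by (auto simp: S2_upto_def S0_upto_def)
  then show M[measurable]: "X t \<in> borel_measurable M" using F_measurableD assms by blast
  obtain Q where Q: "square_integrable M Q" "\<And>\<omega>. \<omega> \<in> space M \<Longrightarrow> norm (X t \<omega>) \<le> Q \<omega>"
    using S2_upto_oscillation[OF X assms] assms by (metis atLeastAtMost_iff order_refl)
  have "square_integrable M (X t)"
    using Q(1) by (rule square_integrable_bound[where C=1]) (use order_trans[OF Q(2) abs_ge_self] in auto)
  moreover have "square_integrable M (\<lambda>_. y)" by (simp add: square_integrable_def)
  ultimately show "square_integrable M (\<lambda>\<omega>. X t \<omega> - y)" by (rule square_integrable_diff)
  show "\<omega> \<in> space M \<Longrightarrow> continuous_on {0..t} (\<lambda>r. X r \<omega>)"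
    using X by (auto simp: S2_upto_def S0_upto_def)
qed

text \<open>This is also the first conjunct of the theorem: a Bochner integral of a non-integrable
  function is 0 by convention, which would make the rate meaningless.\<close>

lemma gap_integrable:
  assumes "0 \<le> t"
  shows "integrable M (\<lambda>\<omega>. f (X t \<omega>) - f z)"
proof (rule Bochner_Integration.integrable_bound)
  show "integrable M (\<lambda>\<omega>. L * (norm (X t \<omega> - z))\<^sup>2)"
    using square_integrableD(2)[OF solution_regularity(3)[OF assms]] by simp
  show "(\<lambda>\<omega>. f (X t \<omega>) - f z) \<in> borel_measurable M"
    using borel_measurable_continuous_on[OF f_continuous solution_regularity(2)[OF assms]] by measurable
  show "AE \<omega> in M. norm (f (X t \<omega>) - f z) \<le> norm (L * (norm (X t \<omega> - z))\<^sup>2)"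
    using f_min gap_le L_nonneg by (intro AE_I2) (simp add: abs_of_nonneg)
qed

section \<open>The Lyapunov function in expectation\<close>

definition lyapunov :: "real \<Rightarrow> 'w \<Rightarrow> real" where
  "lyapunov t \<omega> = t * (f (X t \<omega>) - f z) + (norm (X t \<omega> - z))\<^sup>2 / 2"

lemma lyapunov_integrable: "0 \<le> t \<Longrightarrow> integrable M (lyapunov t)"
  unfolding lyapunov_def[abs_def] using gap_integrable square_integrableD(2)[OF solution_regularity(3)] by simp

text \<open>The coefficient \<open>?G\<close> of the noise depends on the path at time
  \<open>s\<close> only, so the first-order noise term has expectation 0. The bounds
  \<open>w\<close> and \<open>B\<close> are random, and the error stays an expectation of their
  product.\<close>

lemma expectation_lyapunov_step:
  assumes st: "0 \<le> s" "s \<le> t" "t \<le> s + 1" "t \<le> T"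
    and w: "w \<in> borel_measurable M" "\<And>r \<omega>. r \<in> {s..t} \<Longrightarrow> \<omega> \<in> space M \<Longrightarrow> norm (X r \<omega> - X s \<omega>) \<le> w \<omega>"
    and B: "\<And>r \<omega>. r \<in> {s..t} \<Longrightarrow> \<omega> \<in> space M \<Longrightarrow> norm (X r \<omega> - z) \<le> B \<omega>"
    and wB: "integrable M (\<lambda>\<omega>. w \<omega> * B \<omega>)"
  shows "expectation (lyapunov t) \<le> expectation (lyapunov s)
    + 8 * CARD('m) * (L + 1) * (\<Psi> t - \<Psi> s)
    + (t - s) * ((3 * T * L\<^sup>2 + 2 * L) * expectation (\<lambda>\<omega>. w \<omega> * B \<omega>))"
proof -
  have t: "0 \<le> t" using st by simp
  obtain I where ito: "ito_integral M F W (\<lambda>t \<omega>. \<sigma> t (X t \<omega>)) I"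
    and sol: "AE \<omega> in M. \<forall>t\<ge>0. X t \<omega> = X0 + (LINT s:{0..t}|lborel. - gradf (X s \<omega>)) + I t \<omega>"
    using X_sol by (auto simp: sde_solution_def)
  let ?J = "\<lambda>\<omega>. I t \<omega> - I s \<omega>" and ?G = "\<lambda>\<omega>. t *\<^sub>R gradf (X s \<omega>) + (X s \<omega> - z)"
  let ?D = "\<lambda>\<omega>. LINT r:{s<..t}|lborel. gradf (X r \<omega>)"
  have hnn: "(\<integral>\<^sup>+r\<in>{s<..t}. ennreal ((h r)\<^sup>2) \<partial>lborel) = ennreal (LINT r:{s<..t}|lborel. (h r)\<^sup>2)"
  proof -
    have "ennreal (LINT r:{s<..t}|lborel. (h r)\<^sup>2) = (\<integral>\<^sup>+r. ennreal (indicator {s<..t} r *\<^sub>R (h r)\<^sup>2) \<partial>lborel)"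
      unfolding set_lebesgue_integral_def
      using h_integrable(3)[OF st(1), of t] unfolding set_integrable_def
      by (intro nn_integral_eq_integral[symmetric]) auto
    also have "\<dots> = (\<integral>\<^sup>+r\<in>{s<..t}. ennreal ((h r)\<^sup>2) \<partial>lborel)"
      by (intro nn_integral_cong) (auto simp: indicator_def)
    finally show ?thesis ..
  qed
  have "(\<integral>\<^sup>+r\<in>{s<..t}. ennreal ((h r)\<^sup>2) \<partial>lborel) < \<infinity>" unfolding hnn by simp
  note inc = ito_integral_increment[OF ito st(1,2) h_meas _ this]
  have Hle: "norm (\<sigma> r (X r \<omega>)) \<le> h r" if "r \<in> {s<..t}" for r \<omega> using h_bounds(3) that st by auto
  have Jsq: "square_integrable M ?J" using inc(1) Hle by blast
  have J2: "expectation (\<lambda>\<omega>. (norm (?J \<omega>))\<^sup>2) \<le> 4 * CARD('m) * (LINT r:{s<..t}|lborel. (h r)\<^sup>2)"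
  proof -
    have "ennreal (expectation (\<lambda>\<omega>. (norm (?J \<omega>))\<^sup>2)) = (\<integral>\<^sup>+\<omega>. ennreal ((norm (?J \<omega>))\<^sup>2) \<partial>M)"
      using square_integrableD(2)[OF Jsq] by (intro nn_integral_eq_integral[symmetric]) auto
    also have "\<dots> \<le> of_nat (4 * CARD('m)) * ennreal (LINT r:{s<..t}|lborel. (h r)\<^sup>2)"
      using inc(2) Hle unfolding hnn by blast
    also have "\<dots> = ennreal (4 * CARD('m) * (LINT r:{s<..t}|lborel. (h r)\<^sup>2))"
      by (subst ennreal_of_nat_eq_real_of_nat, subst ennreal_mult'[symmetric]) auto
    finally show ?thesis
      by (subst (asm) ennreal_le_iff) (auto simp: set_lebesgue_integral_def)
  qed
  have Xs: "X s \<in> borel_measurable (F s)" "X s \<in> borel_measurable M" using solution_regularity[OF st(1)] by auto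
  have gXs: "(\<lambda>\<omega>. gradf (X s \<omega>)) \<in> borel_measurable (F s)" "(\<lambda>\<omega>. gradf (X s \<omega>)) \<in> borel_measurable M"
    using borel_measurable_continuous_on[OF gradf_continuous] Xs by blast+
  have "square_integrable M (\<lambda>\<omega>. gradf (X s \<omega>))"
    using solution_regularity(3)[OF st(1), of z] gXs(2) by (rule square_integrable_bound[where C=L]) (rule gradf_le)
  then have Gsq: "square_integrable M ?G"
    by (intro square_integrable_add square_integrable_scaleR solution_regularity st)
  have "?G \<in> borel_measurable (F s)" using gXs(1) Xs(1) by measurable
  then have orth: "expectation (\<lambda>\<omega>. ?G \<omega> \<bullet> ?J \<omega>) = 0" using inc(3) Hle Gsq by blast
  \<comment> \<open>The integral equation holds almost surely, simultaneously for all times, so the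
    pathwise inequality is available off one null set.\<close>
  have step: "AE \<omega> in M. lyapunov t \<omega> \<le> lyapunov s \<omega> + ?G \<omega> \<bullet> ?J \<omega> + (t * L + 1 / 2) * (norm (?J \<omega>))\<^sup>2
      + (t - s) * ((3 * T * L\<^sup>2 + 2 * L) * (w \<omega> * B \<omega>))"
    using sol
  proof (rule AE_mp, intro AE_I2 impI)
    fix \<omega> assume \<omega>: "\<omega> \<in> space M"
      and eq: "\<forall>t\<ge>0. X t \<omega> = X0 + (LINT s:{0..t}|lborel. - gradf (X s \<omega>)) + I t \<omega>"
    have gc: "continuous_on {0..t} (\<lambda>r. gradf (X r \<omega>))"
      by (rule continuous_on_compose2[OF gradf_continuous solution_regularity(4)[OF t \<omega>]]) auto
    have gi: "set_integrable lborel {0..t} (\<lambda>r. gradf (X r \<omega>))"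
      unfolding set_integrable_def by (rule borel_integrable_compact[OF _ gc]) simp
    have gi1: "set_integrable lborel {0..s} (\<lambda>r. gradf (X r \<omega>))" "set_integrable lborel {s<..t} (\<lambda>r. gradf (X r \<omega>))"
      using st by (auto intro!: set_integrable_subset[OF gi])
    have "{0..t} = {0..s} \<union> {s<..t}" "{0..s} \<inter> {s<..t} = {}" using st by auto
    then have D: "(LINT r:{0..t}|lborel. gradf (X r \<omega>)) = (LINT r:{0..s}|lborel. gradf (X r \<omega>)) + ?D \<omega>"
      using set_integral_Un[OF _ gi1] by auto
    have neg: "(LINT r:A|lborel. - gradf (X r \<omega>)) = - (LINT r:A|lborel. gradf (X r \<omega>))" for A
      by (simp add: set_lebesgue_integral_def)
    have dx: "X t \<omega> - X s \<omega> = ?J \<omega> - ?D \<omega>"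
    proof -
      have a: "X t \<omega> = X0 - ((LINT r:{0..s}|lborel. gradf (X r \<omega>)) + ?D \<omega>) + I t \<omega>"
        using eq[rule_format, OF t] unfolding neg D by simp
      have b: "X s \<omega> = X0 - (LINT r:{0..s}|lborel. gradf (X r \<omega>)) + I s \<omega>"
        using eq[rule_format, OF st(1)] unfolding neg by simp
      show ?thesis unfolding arg_cong2[OF a b, of minus] by simp
    qed
    have B0: "norm (X r \<omega> - z) \<le> B \<omega>" "norm (X r \<omega> - X s \<omega>) \<le> w \<omega>" if "r \<in> {s..t}" for r
      using B w that \<omega> by auto
    have const: "set_integrable lborel {s<..t} (\<lambda>_. gradf (X s \<omega>))"
      using st by (auto simp: set_integrable_def intro!: integrable_scaleR_left)
    have "?D \<omega> - (t - s) *\<^sub>R gradf (X s \<omega>) = (LINT r:{s<..t}|lborel. gradf (X r \<omega>) - gradf (X s \<omega>))"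
      using gi1(2) const st by (subst set_integral_diff) (auto simp: set_lebesgue_integral_def)
    also have "norm \<dots> \<le> (t - s) * (L * w \<omega>)"
    proof (rule norm_set_integral_le)
      show "norm (gradf (X r \<omega>) - gradf (X s \<omega>)) \<le> L * w \<omega>" if "r \<in> {s<..t}" for r
        using order_trans[OF gradf_diff_le mult_left_mono[OF B0(2) L_nonneg]] that by simp
    qed (use st set_integral_diff(1)[OF gi1(2) const] in auto)
    finally have b1: "norm (?D \<omega> - (t - s) *\<^sub>R gradf (X s \<omega>)) \<le> (t - s) * (L * w \<omega>)" .
    have gB: "norm (gradf (X r \<omega>)) \<le> L * B \<omega>" if "r \<in> {s..t}" for r
      using order_trans[OF gradf_le mult_left_mono[OF B0(1) L_nonneg]] that by simp
    have b2: "norm (?D \<omega>) \<le> (t - s) * (L * B \<omega>)"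
      using st gi1(2) gB by (intro norm_set_integral_le) auto
    have desc: "(f (X t \<omega>) - f z) - (f (X s \<omega>) - f z)
        \<le> gradf (X s \<omega>) \<bullet> (X t \<omega> - X s \<omega>) + L * (norm (X t \<omega> - X s \<omega>))\<^sup>2"
      using lipschitz_gradient_descent[OF f_lipschitz f_deriv] by simp
    show "lyapunov t \<omega> \<le> lyapunov s \<omega> + ?G \<omega> \<bullet> ?J \<omega> + (t * L + 1 / 2) * (norm (?J \<omega>))\<^sup>2
      + (t - s) * ((3 * T * L\<^sup>2 + 2 * L) * (w \<omega> * B \<omega>))"
      unfolding lyapunov_def
      by (rule lyapunov_step[OF dx _ _ st(1,4) desc convex_gradient_inequality[OF f_convex f_deriv]
            b1 B0(2) b2 gB B0(1) L_nonneg])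
        (use st in auto)
  qed
  note int = lyapunov_integrable[OF st(1)] square_integrable_inner[OF Gsq Jsq] square_integrableD(2)[OF Jsq] wB
  have "expectation (lyapunov t) \<le> expectation (\<lambda>\<omega>. lyapunov s \<omega> + ?G \<omega> \<bullet> ?J \<omega> + (t * L + 1 / 2) * (norm (?J \<omega>))\<^sup>2
      + (t - s) * ((3 * T * L\<^sup>2 + 2 * L) * (w \<omega> * B \<omega>)))"
    using int by (intro integral_mono_AE lyapunov_integrable[OF t] step Bochner_Integration.integrable_add integrable_mult_right) auto
  also have "\<dots> = expectation (lyapunov s) + (t * L + 1 / 2) * expectation (\<lambda>\<omega>. (norm (?J \<omega>))\<^sup>2)
      + (t - s) * ((3 * T * L\<^sup>2 + 2 * L) * expectation (\<lambda>\<omega>. w \<omega> * B \<omega>))"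
    using int orth by (simp add: Bochner_Integration.integral_add)
  \<comment> \<open>\<open>t * L + 1 / 2 \<le> (L + 1) * (t + 1)\<close> separates the constant from
    the time weight. The final 8 is the 4 of the stochastic integral times the 2 of the weight
    comparison.\<close>
  also have "(t * L + 1 / 2) * expectation (\<lambda>\<omega>. (norm (?J \<omega>))\<^sup>2)
      \<le> ((L + 1) * (t + 1)) * (4 * CARD('m) * (LINT r:{s<..t}|lborel. (h r)\<^sup>2))"
    using J2 L_nonneg t by (intro mult_mono) (auto simp: algebra_simps)
  also have "\<dots> = 4 * CARD('m) * (L + 1) * ((t + 1) * (LINT r:{s<..t}|lborel. (h r)\<^sup>2))"
    by (simp only: mult_ac)
  also have "\<dots> \<le> 4 * CARD('m) * (L + 1) * (2 * (\<Psi> t - \<Psi> s))"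
    using weighted_noise_le[OF st(1-3)] L_nonneg by (intro mult_left_mono) auto
  finally show ?thesis by (simp add: mult_ac)
qed

text \<open>Over a uniform partition the terms in \<open>\<Psi>\<close> telescope, and the errors,
  each \<open>\<delta>\<close> times the same expectation \<open>e n\<close>, add up to a multiple
  of \<open>T * e n\<close>.\<close>

lemma expectation_lyapunov_le:
  assumes T: "0 \<le> T"
  shows "expectation (lyapunov T) \<le> expectation (lyapunov 0) + 8 * CARD('m) * (L + 1) * \<Psi> T"
proof -
  let ?K = "8 * CARD('m) * (L + 1)" and ?c = "3 * T * L\<^sup>2 + 2 * L"
  have XT: "X \<in> S2_upto M F T" using X_S2 T by (auto simp: S2_def)
  obtain Q osc where Q: "square_integrable M Q" and osc_meas: "\<And>n. osc n \<in> borel_measurable M"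
    and XQ: "\<And>r \<omega>. r \<in> {0..T} \<Longrightarrow> \<omega> \<in> space M \<Longrightarrow> norm (X r \<omega>) \<le> Q \<omega>"
    and osc: "\<And>n r s \<omega>. r \<in> {0..T} \<Longrightarrow> s \<in> {0..T} \<Longrightarrow> \<bar>r - s\<bar> \<le> T / Suc n \<Longrightarrow> \<omega> \<in> space M \<Longrightarrow>
      norm (X r \<omega> - X s \<omega>) \<le> osc n \<omega>"
    and osc_Q: "\<And>n \<omega>. \<omega> \<in> space M \<Longrightarrow> osc n \<omega> \<le> 2 * Q \<omega>"
    and osc_0: "\<And>\<omega>. \<omega> \<in> space M \<Longrightarrow> (\<lambda>n. osc n \<omega>) \<longlonglongrightarrow> (0::real)"
    using S2_upto_oscillation[OF XT T] by metis
  note [measurable] = square_integrableD(1)[OF Q] osc_meas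
  define B where "B \<omega> = Q \<omega> + norm z" for \<omega>
  have Q0: "0 \<le> Q \<omega>" if "\<omega> \<in> space M" for \<omega>
    using order_trans[OF norm_ge_zero XQ[of 0 \<omega>]] T that by simp
  have osc0: "0 \<le> osc n \<omega>" if "\<omega> \<in> space M" for n \<omega>
    using osc[of 0 0 n \<omega>] T that by simp
  have B: "norm (X r \<omega> - z) \<le> B \<omega>" if "r \<in> {0..T}" "\<omega> \<in> space M" for r \<omega>
    unfolding B_def using norm_triangle_ineq4[of "X r \<omega>" z] XQ[OF that] by linarith
  have Bsq: "square_integrable M B"
    unfolding B_def[abs_def] by (intro square_integrable_add Q) (simp add: square_integrable_def)
  have dom: "integrable M (\<lambda>\<omega>. 2 * (Q \<omega> * B \<omega>))"
    using square_integrable_inner[OF Q Bsq] by simp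
  have [measurable]: "B \<in> borel_measurable M" using square_integrableD(1)[OF Bsq] .
  have le_dom: "norm (osc n \<omega> * B \<omega>) \<le> 2 * (Q \<omega> * B \<omega>)" if "\<omega> \<in> space M" for n \<omega>
    using mult_right_mono[OF osc_Q[OF that, of n], of "B \<omega>"] osc0[OF that, of n] Q0[OF that]
    by (simp add: B_def abs_mult mult.assoc)
  have wB: "integrable M (\<lambda>\<omega>. osc n \<omega> * B \<omega>)" for n
    using dom by (rule Bochner_Integration.integrable_bound)
      (use order_trans[OF le_dom abs_ge_self] in \<open>auto intro!: AE_I2\<close>)
  define e where "e n = expectation (\<lambda>\<omega>. osc n \<omega> * B \<omega>)" for n
  \<comment> \<open>Dominated convergence: the oscillation tends to 0 on every path, and
    \<open>osc n \<le> 2 * Q\<close> with \<open>Q\<close> and \<open>B\<close> square integrable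
    gives the dominating function.\<close>
  have "(\<lambda>n. e n) \<longlonglongrightarrow> expectation (\<lambda>\<omega>. 0)"
    unfolding e_def
  proof (rule integral_dominated_convergence[where w = "\<lambda>\<omega>. 2 * (Q \<omega> * B \<omega>)"])
    show "AE \<omega> in M. (\<lambda>n. osc n \<omega> * B \<omega>) \<longlonglongrightarrow> 0"
      using tendsto_mult_right[OF osc_0] by (intro AE_I2) (simp add: mult.commute tendsto_mult_left_zero)
  qed (use dom le_dom in auto)
  then have e: "e \<longlonglongrightarrow> 0" by simp
  \<comment> \<open>The condition on \<open>n\<close> makes the mesh at most 1, as the weight
    comparison requires; it holds for all large \<open>n\<close>.\<close>
  have bound: "expectation (lyapunov T) \<le> expectation (lyapunov 0) + ?K * \<Psi> T + T * (?c * e n)"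
    if n: "T \<le> Suc n" for n
  proof -
    define \<delta> where "\<delta> = T / Suc n"
    have \<delta>: "0 \<le> \<delta>" "\<delta> \<le> 1" "\<delta> * Suc n = T" using T n by (auto simp: \<delta>_def)
    have "expectation (lyapunov (i * \<delta>)) \<le> expectation (lyapunov 0) + ?K * (\<Psi> (i * \<delta>) - \<Psi> 0) + (i * \<delta>) * (?c * e n)"
      if "i \<le> Suc n" for i
      using that
    proof (induction i)
      case 0
      then show ?case by simp
    next
      case (Suc i)
      have iT: "Suc i * \<delta> \<le> T" using mult_left_mono[OF _ \<delta>(1), of "real (Suc i)" "real (Suc n)"] Suc.prems \<delta>(3) by (simp add: mult.commute)
      have i: "0 \<le> i * \<delta>" "i * \<delta> \<le> Suc i * \<delta>" "Suc i * \<delta> \<le> i * \<delta> + 1" "Suc i * \<delta> - i * \<delta> = \<delta>"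
        using \<delta> by (auto simp: algebra_simps)
      have "expectation (lyapunov (Suc i * \<delta>)) \<le> expectation (lyapunov (i * \<delta>))
        + ?K * (\<Psi> (Suc i * \<delta>) - \<Psi> (i * \<delta>)) + (Suc i * \<delta> - i * \<delta>) * (?c * expectation (\<lambda>\<omega>. osc n \<omega> * B \<omega>))"
      proof (rule expectation_lyapunov_step[OF i(1-3) iT osc_meas _ _ wB])
        fix r \<omega> assume r: "r \<in> {i * \<delta>..Suc i * \<delta>}" and \<omega>: "\<omega> \<in> space M"
        have rT: "r \<in> {0..T}"
          using r order_trans[OF i(1), of r] order_trans[OF _ iT, of r] by simp
        show "norm (X r \<omega> - z) \<le> B \<omega>" using B[OF rT \<omega>] .
        have "\<bar>r - i * \<delta>\<bar> \<le> T / Suc n" using r i(4) unfolding \<delta>_def[symmetric] by auto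
        then show "norm (X r \<omega> - X (i * \<delta>) \<omega>) \<le> osc n \<omega>" using osc[OF rT _ _ \<omega>] i iT by auto
      qed
      moreover have "expectation (lyapunov (i * \<delta>)) \<le> expectation (lyapunov 0) + ?K * (\<Psi> (i * \<delta>) - \<Psi> 0) + (i * \<delta>) * (?c * e n)"
        using Suc by simp
      ultimately show ?case unfolding e_def by (simp only: right_diff_distrib left_diff_distrib)
    qed
    from this[of "Suc n"] have "expectation (lyapunov T) \<le> expectation (lyapunov 0) + ?K * (\<Psi> T - \<Psi> 0) + T * (?c * e n)"
      using \<delta>(3) by (simp only: mult.commute[of _ \<delta>])
    moreover have "0 \<le> ?K * \<Psi> 0"
      using L_nonneg unfolding \<Psi>_def set_lebesgue_integral_def
      by (intro mult_nonneg_nonneg integral_nonneg_AE) (auto simp: indicator_def intro!: AE_I2)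
    ultimately show ?thesis unfolding right_diff_distrib by linarith
  qed
  have "(\<lambda>n. expectation (lyapunov 0) + ?K * \<Psi> T + T * (?c * e n)) \<longlonglongrightarrow> expectation (lyapunov 0) + ?K * \<Psi> T + T * (?c * 0)"
    by (intro tendsto_intros e)
  moreover have "\<exists>N. \<forall>n\<ge>N. expectation (lyapunov T) \<le> expectation (lyapunov 0) + ?K * \<Psi> T + T * (?c * e n)"
    using bound real_nat_ceiling_ge[of T] by (intro exI[of _ "nat \<lceil>T\<rceil>"]) (meson le_SucI of_nat_le_iff order_trans)
  ultimately show ?thesis using LIMSEQ_le_const by fastforce
qed

lemma expectation_gap_le:
  assumes T: "0 \<le> T"
  shows "T * expectation (\<lambda>\<omega>. f (X T \<omega>) - f z)
    \<le> expectation (lyapunov 0) + 8 * CARD('m) * (L + 1) * \<Psi> T"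
proof -
  have "T * expectation (\<lambda>\<omega>. f (X T \<omega>) - f z) = expectation (\<lambda>\<omega>. T * (f (X T \<omega>) - f z))"
    by simp
  also have "\<dots> \<le> expectation (lyapunov T)"
    using gap_integrable[OF T] lyapunov_integrable[OF T]
    by (intro integral_mono) (auto simp: lyapunov_def)
  finally show ?thesis using expectation_lyapunov_le[OF T] by linarith
qed

end

section \<open>From the entrywise hypotheses to the rate\<close>

theorem proposition3p3:
  fixes M :: "'w measure" and F :: "real \<Rightarrow> 'w measure"
    and W :: "real \<Rightarrow> 'w \<Rightarrow> real ^ 'm"
    and f :: "real ^ 'd \<Rightarrow> real" and gradf :: "real ^ 'd \<Rightarrow> real ^ 'd"
    and \<sigma> :: "real \<Rightarrow> real ^ 'd \<Rightarrow> real ^ 'm ^ 'd"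
    and X :: "real \<Rightarrow> 'w \<Rightarrow> real ^ 'd" and X0 :: "real ^ 'd"
    and L l0 K \<beta> :: real
  assumes "brownian_motion M F W"
    and "convex_on UNIV f"
    and "\<And>x. GDERIV f x :> gradf x"
    and "continuous_on UNIV gradf"
    and "L-lipschitz_on UNIV gradf"
    and "{x. is_arg_min f (\<lambda>_. True) x} \<noteq> {}"
    and "(\<lambda>(t, x). \<sigma> t x) \<in> borel_measurable (restrict_space borel {0..} \<Otimes>\<^sub>M borel)"
    and "\<And>i k. bdd_above ((\<lambda>(t, x). \<bar>\<sigma> t x $ i $ k\<bar>) ` ({0..} \<times> UNIV))"
    and "l0 > 0"
    and "\<And>i k t x x'. t \<ge> 0 \<Longrightarrow> \<bar>\<sigma> t x' $ i $ k - \<sigma> t x $ i $ k\<bar> \<le> l0 * norm (x' - x)"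
    and "K \<ge> 0" and "\<beta> \<in> {0..<1}"
    and "\<And>t. t \<ge> 0 \<Longrightarrow>
      (LINT s:{0..t}|lborel. (s + 1) * (sigma_inf \<sigma> s)\<^sup>2) \<le> K * t powr \<beta>"
    and "X \<in> S2 M F"
    and "sde_solution M F W (\<lambda>x. - gradf x) \<sigma> X0 X"
  shows "(\<forall>t\<ge>0. integrable M (\<lambda>\<omega>. f (X t \<omega>) - (INF x. f x))) \<and>
    (\<lambda>t. LINT \<omega>|M. f (X t \<omega>) - (INF x. f x)) \<in> O[at_top](\<lambda>t. t powr (\<beta> - 1))"
proof -
  obtain z where z: "\<And>x. f z \<le> f x" using assms(6) by (auto simp: is_arg_min_linorder)
  \<comment> \<open>The infimum is attained, so the gap is measured against
    \<open>f z\<close>.\<close>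
  have inf: "(INF x. f x) = f z" using z by (intro cInf_eq_minimum) auto
  have "\<exists>b. \<forall>t x. 0 \<le> t \<longrightarrow> \<bar>\<sigma> t x $ i $ k\<bar> \<le> b" for i k
    using assms(8)[of i k] by (force simp: bdd_above_def)
  then obtain b where b: "\<And>i k t x. 0 \<le> t \<Longrightarrow> \<bar>\<sigma> t x $ i $ k\<bar> \<le> b i k" by metis
  \<comment> \<open>The sum of the entry bounds dominates the Frobenius norm, since the sum of
    absolute values does.\<close>
  let ?C = "\<Sum>i\<in>UNIV. \<Sum>k\<in>UNIV. b i k"
  have norm_le: "norm A \<le> (\<Sum>i\<in>UNIV. \<Sum>k\<in>UNIV. \<bar>A $ i $ k\<bar>)" for A :: "real^'m^'d"
    unfolding norm_vec_def[of A]
    by (rule order_trans[OF L2_set_le_sum]) (auto intro!: sum_mono norm_le_l1_cart)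
  have C: "norm (\<sigma> t x) \<le> ?C" if "0 \<le> t" for t x
    using b[OF that] by (intro order_trans[OF norm_le] sum_mono)
  have cont: "continuous_on UNIV (\<sigma> t)" if "0 \<le> t" for t
  proof -
    have "(l0)-lipschitz_on UNIV (\<lambda>x. \<sigma> t x $ i $ k)" for i k
      using assms(9) assms(10)[OF that] by (intro lipschitz_onI) (auto simp: dist_norm)
    then have "continuous_on UNIV (\<lambda>x. \<sigma> t x $ i $ k)" for i k
      by (rule lipschitz_on_continuous_on)
    then have "continuous_on UNIV (\<lambda>x. \<chi> i. \<chi> k. \<sigma> t x $ i $ k)"
      by (intro continuous_on_vec_lambda)
    then show ?thesis by simp
  qed
  interpret bm: brownian_motion M F W by fact
  interpret gradient_sde M F W f gradf z \<sigma> X X0 L ?C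
    by unfold_locales (use assms z C cont in auto)
  let ?A = "\<bar>bm.expectation (lyapunov 0)\<bar> + 8 * CARD('m) * (L + 1) * K"
  have "norm (LINT \<omega>|M. f (X t \<omega>) - f z) \<le> ?A * norm (t powr (\<beta> - 1))" if t: "1 \<le> t" for t
  proof -
    let ?g = "LINT \<omega>|M. f (X t \<omega>) - f z"
    have "0 \<le> ?g" using z by (intro integral_nonneg_AE) auto
    \<comment> \<open>For \<open>t \<ge> 1\<close> and a nonnegative exponent, the constant initial
      value can be absorbed into a multiple of \<open>t powr \<beta>\<close>.\<close>
    have "1 \<le> t powr \<beta>" using t assms(12) by (intro ge_one_powr_ge_zero) auto
    have "t * ?g \<le> bm.expectation (lyapunov 0) + 8 * CARD('m) * (L + 1) * \<Psi> t"
      using expectation_gap_le t by simp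
    also have "\<dots> \<le> \<bar>bm.expectation (lyapunov 0)\<bar> * t powr \<beta> + 8 * CARD('m) * (L + 1) * (K * t powr \<beta>)"
      using assms(13)[of t] t L_nonneg mult_left_mono[OF \<open>1 \<le> t powr \<beta>\<close>, of "\<bar>bm.expectation (lyapunov 0)\<bar>"]
      unfolding \<Psi>_def by (intro add_mono mult_left_mono) auto
    also have "\<dots> = ?A * t powr \<beta>" by (simp add: algebra_simps)
    also have "t powr \<beta> = t * t powr (\<beta> - 1)" using t by (simp add: powr_diff)
    finally have "t * ?g \<le> t * (?A * t powr (\<beta> - 1))" by (simp only: mult_ac)
    then have "?g \<le> ?A * t powr (\<beta> - 1)" using t by (simp only: mult_le_cancel_left_pos)
    then show ?thesis using \<open>0 \<le> ?g\<close> by simp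
  qed
  then have "(\<lambda>t. LINT \<omega>|M. f (X t \<omega>) - f z) \<in> O[at_top](\<lambda>t. t powr (\<beta> - 1))"
    by (intro bigoI[where c = ?A] eventually_at_top_linorderI[of 1])
  then show ?thesis unfolding inf using gap_integrable by blast
qed

end
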